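(* Let $\mathcal V$ be the category of vector spaces or of chain complexes over a field $k$, let $X$ be a set, $P$ an $X$-colored (symmetric) operad in $\mathcal V$, $A\in\mathcal V^X$ and $y\in X$. A function $f\in(P(A)_y)^\star$ is representative if and only if it is recursive.
   Context: $V^\star=[V,k]$ is the (internal) dual. $\bar x=(x_1,\dots,x_n)$ denotes a finite sequence of elements of $X$; $P(\bar x;y)$ is the object of operations of $P$ with inputs $\bar x$ and output $y$. $P(A)\in\mathcal V^X$ is the free $P$-algebra on $A$, $P(A)_y=\int^{\bar x\in S(X)}P(\bar x;y)\otimes A_{x_1}\otimes\cdots\otimes A_{x_n}$, where $S(X)$ is the groupoid of finite sequences in $X$ and permutations. An operation $\mu\in P(\bar x;y)$ acts as a map $\mu:P(A)_{x_1}\otimes\cdots\otimes P(A)_{x_n}\to P(A)_y$. A function $f\in(P(A)_y)^\star$ is a linear map $f:P(A)_y\to k$ (an element of the dual). There is a canonical injection $\bigotimes_i(P(A)_{x_i})^\star\subset(\bigotimes_iP(A)_{x_i})^\star$. $f$ is representative if for every sequence $\bar x$ and every operation $\mu\in P(\bar x;y)$ the composite $\Delta^{(\mu)}f:=f\mu\in(\bigotimes_iP(A)_{x_i})^\star$ belongs to the subspace $\bigotimes_i(P(A)_{x_i})^\star$, i.e. is a finite sum $f(\mu(a_1,\dots,a_n))=\sum_jg^{(1,j)}(a_1)\cdots g^{(n,j)}(a_n)$. For $\mu\in P(\bar x;y)$, $1\le m\le n$ and elements $a_i\in P(A)_{x_i}$ ($i\ne m$), the $\mu$-translation of $f$ by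 $(a_i)$ at position $m$ is the function $b\mapsto f(\mu(a_1,\dots,b,\dots,a_n))$ on $P(A)_{x_m}$ ($b$ in position $m$). $f$ is recursive if for every operation $\mu\in P(\bar x;y)$ (each $\mu$ separately) and every position $m$, the space of $\mu$-translations, i.e. the image of the map $\bigotimes_{i\ne m}P(A)_{x_i}\to(P(A)_{x_m})^\star$, $(a_i)\mapsto(b\mapsto f(\mu(a_1,\dots,b,\dots,a_n)))$, is finite dimensional (for chain complexes: finite-dimensional total space). *)

theory Defs
  imports
    "HOL.Vector_Spaces"
    "HOL-Library.Poly_Mapping"
    "HOL-Library.Function_Algebras"
    "HOL-Combinatorics.Permutations"
begin

section \<open>The base category\<close>

text \<open>
  A vector space is encoded as a chain complex concentrated in degree 0.  Complexes are graded by all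
  integers and the differential lowers the degree.  The graded pieces are subspaces of one ambient
  vector space and need not be independent in it.  Thus an element is always accompanied by its
  degree, and any family of complexes can be presented with a common ambient type (that of the direct
  sum of all their pieces).
\<close>

datatype base = Vect | Ch

record ('k, 'v) complex =
  scale :: "'k \<Rightarrow> 'v \<Rightarrow> 'v"
  piece :: "int \<Rightarrow> 'v set"
  bdry :: "int \<Rightarrow> 'v \<Rightarrow> 'v"

definition in_base :: "base \<Rightarrow> ('k::field, 'v::ab_group_add) complex \<Rightarrow> bool" where
  "in_base V C \<longleftrightarrow>
     vector_space (scale C) \<and>
     (\<forall>n. module.subspace (scale C) (piece C n)) \<and>
     (\<forall>n. \<forall>u\<in>piece C n. bdry C n u \<in> piece C (n - 1)) \<and>
     (\<forall>n c. \<forall>u\<in>piece C n. \<forall>v\<in>piece C n.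
        bdry C n (scale C c u + v) = scale C c (bdry C n u) + bdry C n v) \<and>
     (\<forall>n. \<forall>u\<in>piece C n. bdry C (n - 1) (bdry C n u) = 0) \<and>
     (V = Vect \<longrightarrow> (\<forall>n. n \<noteq> 0 \<longrightarrow> piece C n = {0}))"


section \<open>Koszul signs and permutations of blocks\<close>

definition ksgn :: "int \<Rightarrow> 'k::field" where
  "ksgn d = (if even d then 1 else - 1)"

text \<open>Sign of rearranging symbols of degrees \<open>ds\<close> into the order \<open>permute_list \<sigma>\<close>.\<close>

definition koszul :: "(nat \<Rightarrow> nat) \<Rightarrow> int list \<Rightarrow> 'k::field" where
  "koszul \<sigma> ds =
     ksgn (\<Sum>(i, j)\<in>{(i, j). i < j \<and> j < length ds \<and> \<sigma> j < \<sigma> i}. ds ! \<sigma> i * ds ! \<sigma> j)"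

text \<open>
  Sign of rearranging \<open>u\<^sub>0 \<dots> u\<^sub>n v\<^sub>0 \<dots> v\<^sub>n\<close> into \<open>u\<^sub>0 v\<^sub>0 \<dots> u\<^sub>n v\<^sub>n\<close>, where the
  \<open>u\<^sub>i\<close> have degrees \<open>ds\<close> and the \<open>v\<^sub>i\<close> have degrees \<open>es\<close>.
\<close>

definition shuffle_sgn :: "int list \<Rightarrow> int list \<Rightarrow> 'k::field" where
  "shuffle_sgn ds es = ksgn (\<Sum>i<length ds. \<Sum>j<i. ds ! i * es ! j)"

text \<open>
  \<open>{..<sum_list ks}\<close> cut into consecutive blocks of lengths \<open>ks\<close>.  With
  \<open>ks = map length wss\<close>, permuting \<open>concat wss\<close> by \<open>block_perm \<sigma> ks\<close> permutes the blocks \<open>wss\<close> by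
  \<open>\<sigma>\<close>, and permuting it by \<open>sum_perm \<sigma>s ks\<close> permutes each block \<open>wss ! i\<close> internally by \<open>\<sigma>s ! i\<close>.
\<close>

definition blocks :: "nat list \<Rightarrow> nat list list" where
  "blocks ks = map (\<lambda>i. [sum_list (take i ks)..<sum_list (take (Suc i) ks)]) [0..<length ks]"

definition block_perm :: "(nat \<Rightarrow> nat) \<Rightarrow> nat list \<Rightarrow> nat \<Rightarrow> nat" where
  "block_perm \<sigma> ks t =
     (if t < sum_list ks then concat (permute_list \<sigma> (blocks ks)) ! t else t)"

definition sum_perm :: "(nat \<Rightarrow> nat) list \<Rightarrow> nat list \<Rightarrow> nat \<Rightarrow> nat" where
  "sum_perm \<sigma>s ks t =
     (if t < sum_list ks then concat (map2 permute_list \<sigma>s (blocks ks)) ! t else t)"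


section \<open>Coloured symmetric operads\<close>

text \<open>
  A homogeneous operation together with its input colours, output colour and degree; the structure
  maps of an operad are functions of such tagged operations.
\<close>

record ('x, 'p) oper =
  inp :: "'x list"
  out :: 'x
  deg :: int
  vec :: 'p

record ('k, 'x, 'p) operad =
  hom :: "'x list \<Rightarrow> 'x \<Rightarrow> ('k, 'p) complex"
  ident :: "'x \<Rightarrow> 'p"
  gamma :: "('x, 'p) oper \<Rightarrow> ('x, 'p) oper list \<Rightarrow> 'p"
  act :: "('x, 'p) oper \<Rightarrow> (nat \<Rightarrow> nat) \<Rightarrow> 'p"

definition Ops :: "('k, 'x, 'p) operad \<Rightarrow> ('x, 'p) oper set" where
  "Ops P = {m. vec m \<in> piece (hom P (inp m) (out m)) (deg m)}"

definition osc :: "('k, 'x, 'p) operad \<Rightarrow> ('x, 'p) oper \<Rightarrow> 'k \<Rightarrow> 'p \<Rightarrow> 'p" where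
  "osc P m = scale (hom P (inp m) (out m))"

definition d_op :: "('k, 'x, 'p) operad \<Rightarrow> ('x, 'p) oper \<Rightarrow> ('x, 'p) oper" where
  "d_op P m = m\<lparr>deg := deg m - 1, vec := bdry (hom P (inp m) (out m)) (deg m) (vec m)\<rparr>"

definition id_op :: "('k, 'x, 'p) operad \<Rightarrow> 'x \<Rightarrow> ('x, 'p) oper" where
  "id_op P x = \<lparr>inp = [x], out = x, deg = 0, vec = ident P x\<rparr>"

definition comp_op :: "('k, 'x, 'p) operad \<Rightarrow> ('x, 'p) oper \<Rightarrow> ('x, 'p) oper list \<Rightarrow> ('x, 'p) oper"
  where
  "comp_op P m ns =
     \<lparr>inp = concat (map inp ns), out = out m, deg = deg m + sum_list (map deg ns),
      vec = gamma P m ns\<rparr>"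

definition act_op :: "('k, 'x, 'p) operad \<Rightarrow> ('x, 'p) oper \<Rightarrow> (nat \<Rightarrow> nat) \<Rightarrow> ('x, 'p) oper" where
  "act_op P m \<sigma> = m\<lparr>inp := permute_list \<sigma> (inp m), vec := act P m \<sigma>\<rparr>"

definition composable :: "('k, 'x, 'p) operad \<Rightarrow> ('x, 'p) oper \<Rightarrow> ('x, 'p) oper list \<Rightarrow> bool" where
  "composable P m ns \<longleftrightarrow> m \<in> Ops P \<and> set ns \<subseteq> Ops P \<and> map out ns = inp m"

text \<open>
  The multilinear maps \<open>gamma\<close> are the components
  \<open>P(x\<^sub>1,\<dots>,x\<^sub>n; y) \<otimes> P(w\<^sub>1; x\<^sub>1) \<otimes> \<dots> \<otimes> P(w\<^sub>n; x\<^sub>n) \<rightarrow> P(w\<^sub>1\<dots>w\<^sub>n; y)\<close> of the composition, and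
  \<open>act\<close> is the right action \<open>P(x\<^sub>0,\<dots>,x\<^sub>n; y) \<rightarrow> P(x\<^bsub>\<sigma> 0\<^esub>,\<dots>,x\<^bsub>\<sigma> n\<^esub>; y)\<close>.
\<close>

locale symmetric_operad =
  fixes V :: base and P :: "('k::field, 'x, 'p::ab_group_add) operad"
  assumes hom_in_base: "in_base V (hom P xs y)"
    and id_op: "id_op P x \<in> Ops P"
    and id_op_bdry: "vec (d_op P (id_op P x)) = 0"
    and comp_op: "composable P m ns \<Longrightarrow> comp_op P m ns \<in> Ops P"
    and gamma_linear_root:
      "\<lbrakk>composable P m ns; m\<lparr>vec := u\<rparr> \<in> Ops P\<rbrakk> \<Longrightarrow>
       gamma P (m\<lparr>vec := osc P m c (vec m) + u\<rparr>) ns =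
         osc P (comp_op P m ns) c (gamma P m ns) + gamma P (m\<lparr>vec := u\<rparr>) ns"
    and gamma_linear_leaf:
      "\<lbrakk>composable P m ns; i < length ns; n = ns ! i; n\<lparr>vec := u\<rparr> \<in> Ops P\<rbrakk> \<Longrightarrow>
       gamma P m (ns[i := n\<lparr>vec := osc P n c (vec n) + u\<rparr>]) =
         osc P (comp_op P m ns) c (gamma P m ns) + gamma P m (ns[i := n\<lparr>vec := u\<rparr>])"
    and gamma_bdry:
      "composable P m ns \<Longrightarrow>
       vec (d_op P (comp_op P m ns)) =
         gamma P (d_op P m) ns +
         (\<Sum>i<length ns. osc P (comp_op P m ns) (ksgn (deg m + (\<Sum>j<i. deg (ns ! j))))
            (gamma P m (ns[i := d_op P (ns ! i)])))"
    and gamma_id_left: "m \<in> Ops P \<Longrightarrow> gamma P (id_op P (out m)) [m] = vec m"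
    and gamma_id_right: "m \<in> Ops P \<Longrightarrow> gamma P m (map (id_op P) (inp m)) = vec m"
    and gamma_assoc:
      "\<lbrakk>composable P m ns; length lss = length ns;
        \<And>i. i < length ns \<Longrightarrow> composable P (ns ! i) (lss ! i)\<rbrakk> \<Longrightarrow>
       gamma P (comp_op P m ns) (concat lss) =
         osc P (comp_op P (comp_op P m ns) (concat lss))
           (shuffle_sgn (map deg ns) (map (\<lambda>ls. sum_list (map deg ls)) lss))
           (gamma P m (map2 (comp_op P) ns lss))"
    and act_op: "\<lbrakk>m \<in> Ops P; \<sigma> permutes {..<length (inp m)}\<rbrakk> \<Longrightarrow> act_op P m \<sigma> \<in> Ops P"
    and act_linear:
      "\<lbrakk>m \<in> Ops P; m\<lparr>vec := u\<rparr> \<in> Ops P; \<sigma> permutes {..<length (inp m)}\<rbrakk> \<Longrightarrow>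
       act P (m\<lparr>vec := osc P m c (vec m) + u\<rparr>) \<sigma> =
         osc P (act_op P m \<sigma>) c (act P m \<sigma>) + act P (m\<lparr>vec := u\<rparr>) \<sigma>"
    and act_bdry:
      "\<lbrakk>m \<in> Ops P; \<sigma> permutes {..<length (inp m)}\<rbrakk> \<Longrightarrow>
       vec (d_op P (act_op P m \<sigma>)) = act P (d_op P m) \<sigma>"
    and act_id: "m \<in> Ops P \<Longrightarrow> act P m id = vec m"
    and act_comp:
      "\<lbrakk>m \<in> Ops P; \<sigma> permutes {..<length (inp m)}; \<tau> permutes {..<length (inp m)}\<rbrakk> \<Longrightarrow>
       act P (act_op P m \<sigma>) \<tau> = act P m (\<sigma> \<circ> \<tau>)"
    and equivariant_outer:
      "\<lbrakk>composable P m ns; \<sigma> permutes {..<length ns}\<rbrakk> \<Longrightarrow>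
       gamma P (act_op P m \<sigma>) (permute_list \<sigma> ns) =
         osc P (comp_op P (act_op P m \<sigma>) (permute_list \<sigma> ns)) (koszul \<sigma> (map deg ns))
           (act P (comp_op P m ns) (block_perm \<sigma> (map (length \<circ> inp) ns)))"
    and equivariant_inner:
      "\<lbrakk>composable P m ns; length \<sigma>s = length ns;
        \<And>i. i < length ns \<Longrightarrow> (\<sigma>s ! i) permutes {..<length (inp (ns ! i))}\<rbrakk> \<Longrightarrow>
       gamma P m (map2 (act_op P) ns \<sigma>s) =
         act P (comp_op P m ns) (sum_perm \<sigma>s (map (length \<circ> inp) ns))"


section \<open>The free algebra\<close>

text \<open>
  The coend \<open>P(A)\<^sub>y\<close> is presented by generators and relations: it is the free vector space on
  the corollas \<open>\<mu> \<otimes> a\<^sub>1 \<otimes> \<dots> \<otimes> a\<^sub>n\<close> with homogeneous entries, modulo linearity in each entry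
  (which gives the direct sum of the tensor products over all input sequences) and the identifications
  along the morphisms of the groupoid of finite sequences.  A leaf is a pair of a degree and an element
  of \<open>A\<close> in that degree; the colours of the leaves are the inputs of the root.  Neither property
  of functions considered below involves the differential of \<open>P(A)\<^sub>y\<close>, so only the underlying graded
  space is constructed.
\<close>

record ('x, 'p, 'a) corolla =
  root :: "('x, 'p) oper"
  leaves :: "(int \<times> 'a) list"

definition cdeg :: "('x, 'p, 'a) corolla \<Rightarrow> int" where
  "cdeg g = deg (root g) + sum_list (map fst (leaves g))"

definition corollas ::
    "('k, 'x, 'p) operad \<Rightarrow> ('x \<Rightarrow> ('k, 'a) complex) \<Rightarrow> 'x \<Rightarrow> ('x, 'p, 'a) corolla set" where
  "corollas P A y =
     {g. root g \<in> Ops P \<and> out (root g) = y \<and>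
         list_all2 (\<lambda>x (d, a). a \<in> piece (A x) d) (inp (root g)) (leaves g)}"

definition pscale :: "'k::field \<Rightarrow> ('g \<Rightarrow>\<^sub>0 'k) \<Rightarrow> ('g \<Rightarrow>\<^sub>0 'k)" where
  "pscale c u = Poly_Mapping.map ((*) c) u"

lemma lookup_pscale: "Poly_Mapping.lookup (pscale c u) g = c * Poly_Mapping.lookup u g"
  by (simp add: pscale_def map.rep_eq when_def)

lemma vector_space_pscale: "vector_space (pscale :: 'k::field \<Rightarrow> ('g \<Rightarrow>\<^sub>0 'k) \<Rightarrow> _)"
  by unfold_locales
    (auto simp: poly_mapping_eq_iff fun_eq_iff lookup_pscale lookup_add algebra_simps)

abbreviation gen :: "('x, 'p, 'a) corolla \<Rightarrow> (('x, 'p, 'a) corolla \<Rightarrow>\<^sub>0 'k::field)" where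
  "gen g \<equiv> Poly_Mapping.single g 1"

inductive_set relators ::
    "('k::field, 'x, 'p::ab_group_add) operad \<Rightarrow> ('x \<Rightarrow> ('k, 'a::ab_group_add) complex) \<Rightarrow> 'x \<Rightarrow>
     (('x, 'p, 'a) corolla \<Rightarrow>\<^sub>0 'k) set"
  for P A y where
  linear_root:
    "\<lbrakk>\<lparr>root = m, leaves = ls\<rparr> \<in> corollas P A y; m\<lparr>vec := u\<rparr> \<in> Ops P\<rbrakk> \<Longrightarrow>
     gen \<lparr>root = m\<lparr>vec := osc P m c (vec m) + u\<rparr>, leaves = ls\<rparr>
       - (pscale c (gen \<lparr>root = m, leaves = ls\<rparr>) + gen \<lparr>root = m\<lparr>vec := u\<rparr>, leaves = ls\<rparr>)
     \<in> relators P A y"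
| linear_leaf:
    "\<lbrakk>\<lparr>root = m, leaves = ls\<rparr> \<in> corollas P A y; i < length ls; ls ! i = (d, a);
      b \<in> piece (A (inp m ! i)) d\<rbrakk> \<Longrightarrow>
     gen \<lparr>root = m, leaves = ls[i := (d, scale (A (inp m ! i)) c a + b)]\<rparr>
       - (pscale c (gen \<lparr>root = m, leaves = ls\<rparr>) + gen \<lparr>root = m, leaves = ls[i := (d, b)]\<rparr>)
     \<in> relators P A y"
| symmetry:
    "\<lbrakk>\<lparr>root = m, leaves = ls\<rparr> \<in> corollas P A y; \<sigma> permutes {..<length ls}\<rbrakk> \<Longrightarrow>
     pscale (koszul \<sigma> (map fst ls)) (gen \<lparr>root = act_op P m \<sigma>, leaves = permute_list \<sigma> ls\<rparr>)
       - gen \<lparr>root = m, leaves = ls\<rparr>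
     \<in> relators P A y"

definition Free ::
    "('k::field, 'x, 'p) operad \<Rightarrow> ('x \<Rightarrow> ('k, 'a) complex) \<Rightarrow> 'x \<Rightarrow>
     (('x, 'p, 'a) corolla \<Rightarrow>\<^sub>0 'k) set" where
  "Free P A y = {u. Poly_Mapping.keys u \<subseteq> corollas P A y}"

definition Free_deg ::
    "('k::field, 'x, 'p) operad \<Rightarrow> ('x \<Rightarrow> ('k, 'a) complex) \<Rightarrow> 'x \<Rightarrow> int \<Rightarrow>
     (('x, 'p, 'a) corolla \<Rightarrow>\<^sub>0 'k) set" where
  "Free_deg P A y n = {u \<in> Free P A y. \<forall>g\<in>Poly_Mapping.keys u. cdeg g = n}"

definition free_rel ::
    "('k::field, 'x, 'p::ab_group_add) operad \<Rightarrow> ('x \<Rightarrow> ('k, 'a::ab_group_add) complex) \<Rightarrow> 'x \<Rightarrow>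
     ((('x, 'p, 'a) corolla \<Rightarrow>\<^sub>0 'k) \<times> (('x, 'p, 'a) corolla \<Rightarrow>\<^sub>0 'k)) set" where
  "free_rel P A y =
     {(u, v). u \<in> Free P A y \<and> v \<in> Free P A y \<and> u - v \<in> module.span pscale (relators P A y)}"

type_synonym ('k, 'x, 'p, 'a) free_elt = "(('x, 'p, 'a) corolla \<Rightarrow>\<^sub>0 'k) set"

definition cls ::
    "('k::field, 'x, 'p::ab_group_add) operad \<Rightarrow> ('x \<Rightarrow> ('k, 'a::ab_group_add) complex) \<Rightarrow> 'x \<Rightarrow>
     (('x, 'p, 'a) corolla \<Rightarrow>\<^sub>0 'k) \<Rightarrow> ('k, 'x, 'p, 'a) free_elt" where
  "cls P A y u = free_rel P A y `` {u}"

definition free_alg ::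
    "('k::field, 'x, 'p::ab_group_add) operad \<Rightarrow> ('x \<Rightarrow> ('k, 'a::ab_group_add) complex) \<Rightarrow> 'x \<Rightarrow>
     ('k, 'x, 'p, 'a) free_elt set" where
  "free_alg P A y = Free P A y // free_rel P A y"

text \<open>
  \<open>\<mu>(\<nu>\<^sub>1 \<otimes> a\<^sub>1, \<dots>, \<nu>\<^sub>n \<otimes> a\<^sub>n) = \<plusminus> \<mu>(\<nu>\<^sub>1, \<dots>, \<nu>\<^sub>n) \<otimes> a\<^sub>1 \<otimes> \<dots> \<otimes> a\<^sub>n\<close>, where each
  \<open>a\<^sub>i\<close> is a tensor of leaves; extended multilinearly to \<open>Free\<close> and then passed to classes.
\<close>

definition graft ::
    "('k, 'x, 'p) operad \<Rightarrow> ('x, 'p) oper \<Rightarrow> ('x, 'p, 'a) corolla list \<Rightarrow> ('x, 'p, 'a) corolla" where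
  "graft P m gs = \<lparr>root = comp_op P m (map root gs), leaves = concat (map leaves gs)\<rparr>"

definition graft_sgn :: "('x, 'p, 'a) corolla list \<Rightarrow> 'k::field" where
  "graft_sgn gs =
     shuffle_sgn (map (deg \<circ> root) gs) (map (\<lambda>g. sum_list (map fst (leaves g))) gs)"

definition act_Free ::
    "('k::field, 'x, 'p) operad \<Rightarrow> ('x, 'p) oper \<Rightarrow> (('x, 'p, 'a) corolla \<Rightarrow>\<^sub>0 'k) list \<Rightarrow>
     (('x, 'p, 'a) corolla \<Rightarrow>\<^sub>0 'k)" where
  "act_Free P m us =
     (\<Sum>gs\<in>listset (map Poly_Mapping.keys us).
        Poly_Mapping.single (graft P m gs)
          (graft_sgn gs * prod_list (map2 Poly_Mapping.lookup us gs)))"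

definition action ::
    "('k::field, 'x, 'p::ab_group_add) operad \<Rightarrow> ('x \<Rightarrow> ('k, 'a::ab_group_add) complex) \<Rightarrow>
     ('x, 'p) oper \<Rightarrow> ('k, 'x, 'p, 'a) free_elt list \<Rightarrow> ('k, 'x, 'p, 'a) free_elt" where
  "action P A m Bs = (\<Union>us\<in>listset Bs. cls P A (out m) (act_Free P m us))"


section \<open>Representative and recursive functions\<close>

definition fscale :: "'k::field \<Rightarrow> ('b \<Rightarrow> 'k) \<Rightarrow> ('b \<Rightarrow> 'k)" where
  "fscale c g = (\<lambda>b. c * g b)"

lemma vector_space_fscale: "vector_space (fscale :: 'k::field \<Rightarrow> ('b \<Rightarrow> 'k) \<Rightarrow> _)"
  by unfold_locales (auto simp: fscale_def fun_eq_iff algebra_simps)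

text \<open>
  The dual of \<open>P(A)\<^sub>y\<close>.  The internal hom \<open>[C, k]\<close> of complexes has \<open>Hom(C\<^sub>n, k)\<close> in
  degree \<open>-n\<close>, so its elements are the functionals that vanish in all but finitely many degrees (in
  the case of vector spaces this is no restriction).  Functionals are extended by 0 outside
  \<open>P(A)\<^sub>y\<close>.
\<close>

definition dual ::
    "('k::field, 'x, 'p::ab_group_add) operad \<Rightarrow> ('x \<Rightarrow> ('k, 'a::ab_group_add) complex) \<Rightarrow> 'x \<Rightarrow>
     (('k, 'x, 'p, 'a) free_elt \<Rightarrow> 'k) set" where
  "dual P A y =
     {f. (\<forall>u\<in>Free P A y. \<forall>v\<in>Free P A y.
            f (cls P A y (u + v)) = f (cls P A y u) + f (cls P A y v)) \<and>
         (\<forall>c. \<forall>u\<in>Free P A y. f (cls P A y (pscale c u)) = c * f (cls P A y u)) \<and>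
         finite {n. \<exists>u\<in>Free_deg P A y n. f (cls P A y u) \<noteq> 0} \<and>
         (\<forall>B. B \<notin> free_alg P A y \<longrightarrow> f B = 0)}"

text \<open>
  Elements of \<open>(\<Otimes>\<^sub>i P(A)\<^bsub>x\<^sub>i\<^esub>)\<^sup>\<star>\<close> are treated as multilinear functions.  The
  coefficients \<open>c j\<close> matter only for nullary operations, where the tensor product of duals is \<open>k\<close>;
  they also absorb the Koszul signs of the inclusion of the tensor product of duals.
\<close>

definition representative ::
    "('k::field, 'x, 'p::ab_group_add) operad \<Rightarrow> ('x \<Rightarrow> ('k, 'a::ab_group_add) complex) \<Rightarrow> 'x \<Rightarrow>
     (('k, 'x, 'p, 'a) free_elt \<Rightarrow> 'k) \<Rightarrow> bool" where
  "representative P A y f \<longleftrightarrow>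
     (\<forall>m\<in>Ops P. out m = y \<longrightarrow>
        (\<exists>(r::nat) c g.
           (\<forall>j<r. \<forall>i<length (inp m). g j i \<in> dual P A (inp m ! i)) \<and>
           (\<forall>Bs\<in>listset (map (free_alg P A) (inp m)).
              f (action P A m Bs) = (\<Sum>j<r. c j * (\<Prod>i<length (inp m). g j i (Bs ! i))))))"

text \<open>In \<open>translation P A f m i Bs\<close> the entry \<open>Bs ! i\<close> is irrelevant.\<close>

definition translation ::
    "('k::field, 'x, 'p::ab_group_add) operad \<Rightarrow> ('x \<Rightarrow> ('k, 'a::ab_group_add) complex) \<Rightarrow>
     (('k, 'x, 'p, 'a) free_elt \<Rightarrow> 'k) \<Rightarrow> ('x, 'p) oper \<Rightarrow> nat \<Rightarrow>
     ('k, 'x, 'p, 'a) free_elt list \<Rightarrow> ('k, 'x, 'p, 'a) free_elt \<Rightarrow> 'k" where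
  "translation P A f m i Bs =
     (\<lambda>B. if B \<in> free_alg P A (inp m ! i) then f (action P A m (Bs[i := B])) else 0)"

definition translation_space ::
    "('k::field, 'x, 'p::ab_group_add) operad \<Rightarrow> ('x \<Rightarrow> ('k, 'a::ab_group_add) complex) \<Rightarrow>
     (('k, 'x, 'p, 'a) free_elt \<Rightarrow> 'k) \<Rightarrow> ('x, 'p) oper \<Rightarrow> nat \<Rightarrow>
     (('k, 'x, 'p, 'a) free_elt \<Rightarrow> 'k) set" where
  "translation_space P A f m i =
     module.span fscale (translation P A f m i ` listset (map (free_alg P A) (inp m)))"

definition recursive ::
    "('k::field, 'x, 'p::ab_group_add) operad \<Rightarrow> ('x \<Rightarrow> ('k, 'a::ab_group_add) complex) \<Rightarrow> 'x \<Rightarrow>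
     (('k, 'x, 'p, 'a) free_elt \<Rightarrow> 'k) \<Rightarrow> bool" where
  "recursive P A y f \<longleftrightarrow>
     (\<forall>m\<in>Ops P. out m = y \<longrightarrow>
        (\<forall>i<length (inp m). \<exists>G. finite G \<and> translation_space P A f m i = module.span fscale G))"

end

theory Submission
  imports Defs
begin

text \<open>
  If \<open>f\<mu> = \<Sum>\<^sub>j g\<^sub>1\<^sub>j \<otimes> \<dots> \<otimes> g\<^sub>n\<^sub>j\<close>, then the translations of \<open>f\<close> at position \<open>m\<close> are combinations
  of the finitely many \<open>g\<^sub>m\<^sub>j\<close>.  Conversely, a finite-dimensional space \<open>T\<close> of functions has elements
  \<open>e\<^sub>a\<close> and points \<open>b\<^sub>a\<close> with \<open>h = \<Sum>\<^sub>a h(b\<^sub>a) e\<^sub>a\<close> for all \<open>h\<close> in \<open>T\<close>.  If \<open>T\<close> is the space of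
  translations at position \<open>m\<close>, this rewrites \<open>f(\<mu>(a\<^sub>1, \<dots>, a\<^sub>n))\<close> as
  \<open>\<Sum>\<^sub>a f(\<mu>(a\<^sub>1, \<dots>, b\<^sub>a, \<dots>, a\<^sub>n)) e\<^sub>a(a\<^sub>m)\<close>, and doing so at every position in turn splits \<open>f\<mu>\<close> completely.
  The factors \<open>e\<^sub>a\<close> lie in the dual because translations do.  This needs that \<open>\<mu>\<close> acts
  multilinearly on the quotient \<open>P(A)\<close>, i.e. that grafting a relator between fixed corollas again
  gives a multiple of a relator.
\<close>

section \<open>Multilinear functions with finite-dimensional translation spaces\<close>

lemma mem_listset_iff: "xs \<in> listset As \<longleftrightarrow> list_all2 (\<in>) xs As"
proof (induction As arbitrary: xs)
  case (Cons A As)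
  then show ?case by (cases xs) (auto simp: set_Cons_def)
qed simp

lemma mem_listset_conv_nth:
  "xs \<in> listset As \<longleftrightarrow> length xs = length As \<and> (\<forall>i<length As. xs ! i \<in> As ! i)"
  by (auto simp: mem_listset_iff list_all2_conv_all_nth)

lemma listset_update:
  "\<lbrakk>xs \<in> listset As; x \<in> As ! i\<rbrakk> \<Longrightarrow> xs[i := x] \<in> listset As"
  unfolding mem_listset_conv_nth by (metis length_list_update nth_list_update_eq nth_list_update_neq)

lemma finite_listset: "\<forall>A\<in>set As. finite A \<Longrightarrow> finite (listset As)"
  by (induction As) (auto simp: set_Cons_def intro!: finite_image_set2)

text \<open>Isolates one entry of a list. The splitting is unique because \<open>As\<close>
  prescribes the length of the prefix. It serves to reindex the sum that defines
  \<open>act_Free\<close>.\<close>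

lemma bij_betw_listset_split:
  "bij_betw (\<lambda>(xs, x, ys). xs @ x # ys) (listset As \<times> A \<times> listset Bs) (listset (As @ A # Bs))"
  unfolding bij_betw_def
proof
  show "inj_on (\<lambda>(xs, x, ys). xs @ x # ys) (listset As \<times> A \<times> listset Bs)"
    by (auto simp: inj_on_def mem_listset_iff dest!: list_all2_lengthD)
  show "(\<lambda>(xs, x, ys). xs @ x # ys) ` (listset As \<times> A \<times> listset Bs) = listset (As @ A # Bs)"
  proof (intro equalityI subsetI)
    fix zs assume "zs \<in> listset (As @ A # Bs)"
    then obtain xs x ys where "zs = xs @ x # ys" "xs \<in> listset As" "x \<in> A" "ys \<in> listset Bs"
      unfolding mem_listset_iff list_all2_append2 list_all2_Cons2 by blast
    then show "zs \<in> (\<lambda>(xs, x, ys). xs @ x # ys) ` (listset As \<times> A \<times> listset Bs)"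
      by (intro image_eqI[of _ _ "(xs, x, ys)"]) auto
  qed (auto simp: mem_listset_iff intro: list_all2_appendI)
qed

interpretation pm: vector_space "pscale :: 'k::field \<Rightarrow> ('g \<Rightarrow>\<^sub>0 'k) \<Rightarrow> _"
  by (rule vector_space_pscale)

interpretation fn: vector_space "fscale :: 'k::field \<Rightarrow> ('b \<Rightarrow> 'k) \<Rightarrow> _"
  by (rule vector_space_fscale)

section \<open>Coordinates on a finite-dimensional space of functions\<close>

lemma sum_fun_apply: "(\<Sum>a\<in>I. h a) x = (\<Sum>a\<in>I. h a x :: 'k::comm_monoid_add)"
  by (induction I rule: infinite_finite_induct) auto

text \<open>Interpolation in the style of Newton, by induction on the generators: the points
  \<open>b a\<close> are nodes and the functions \<open>e a\<close> are the matching interpolating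
  functions. Some function of the span is nonzero at each node; this later forces the nodes into the
  free algebra, since functionals are 0 outside it.\<close>

lemma function_space_dual_basis:
  fixes G :: "('b \<Rightarrow> 'k::field) set"
  assumes "finite G"
  shows "\<exists>(r::nat) e b. (\<forall>a<r. e a \<in> fn.span G \<and> (\<exists>h\<in>fn.span G. h (b a) \<noteq> 0)) \<and>
    (\<forall>h\<in>fn.span G. \<forall>x. h x = (\<Sum>a<r. h (b a) * e a x))"
  using assms
proof (induction G)
  case empty
  then show ?case by (intro exI[of _ 0]) (auto simp: fn.span_empty)
next
  case (insert g G)
  then obtain r :: nat and e b where
    eb: "\<And>a. a < r \<Longrightarrow> e a \<in> fn.span G" "\<And>a. a < r \<Longrightarrow> \<exists>h\<in>fn.span G. h (b a) \<noteq> 0"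
    and h: "\<And>h x. h \<in> fn.span G \<Longrightarrow> h x = (\<Sum>a<r. h (b a) * e a x)"
    by blast
  have mono: "fn.span G \<subseteq> fn.span (insert g G)" by (intro fn.span_mono) auto
  \<comment> \<open>The interpolation error of the new generator at the old nodes. If it vanishes
    identically, the old data still reproduce everything; otherwise a point where it is nonzero
    becomes a new node.\<close>
  define g' where "g' = g - (\<Sum>a<r. fscale (g (b a)) (e a))"
  have g'x: "g' x = g x - (\<Sum>a<r. g (b a) * e a x)" for x
    by (simp add: g'_def fscale_def sum_fun_apply)
  have *: "\<exists>c h0. h0 \<in> fn.span G \<and> h = fscale c g + h0" if "h \<in> fn.span (insert g G)" for h
  proof -
    from that obtain c where "h - fscale c g \<in> fn.span G"
      by (auto simp: fn.span_breakdown_eq)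
    then show ?thesis
      by (intro exI[of _ c] exI[of _ "h - fscale c g"]) simp
  qed
  show ?case
  proof (cases "g' = 0")
    case True
    then have gx: "g x = (\<Sum>a<r. g (b a) * e a x)" for x
      using g'x[of x] by (simp add: fun_eq_iff)
    have "h x = (\<Sum>a<r. h (b a) * e a x)" if "h \<in> fn.span (insert g G)" for h x
    proof -
      from *[OF that] obtain c h0 where "h0 \<in> fn.span G" and hh: "h = fscale c g + h0" by blast
      then show ?thesis
        using h[of h0 x] gx[of x]
        by (simp add: hh fscale_def distrib_right sum.distrib mult.assoc flip: sum_distrib_left)
    qed
    then show ?thesis
      using eb mono by (intro exI[of _ r] exI[of _ e] exI[of _ b]) blast
  next
    case False
    then obtain z where z: "g' z \<noteq> 0" by (auto simp: fun_eq_iff)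
    have g'_span: "g' \<in> fn.span (insert g G)"
      unfolding g'_def using eb(1) mono
      by (intro fn.span_diff fn.span_sum fn.span_scale) (auto intro: fn.span_base)
    \<comment> \<open>Normalised to take the value 1 at the new node \<open>z\<close>.\<close>
    define n where "n = fscale (inverse (g' z)) g'"
    have nx: "n x = g' x / g' z" for x by (simp add: n_def fscale_def field_simps)
    \<comment> \<open>The old functions are corrected so as to vanish at \<open>z\<close>, and
      \<open>n\<close> is the function belonging to \<open>z\<close>.\<close>
    define e' where "e' a = (if a < r then e a - fscale (e a z) n else n)" for a
    define b' where "b' a = (if a < r then b a else z)" for a
    have n_span: "n \<in> fn.span (insert g G)"
      unfolding n_def by (intro fn.span_scale g'_span)
    \<comment> \<open>The new interpolant is the old one plus the old error at \<open>z\<close>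
      times \<open>n\<close>. For functions in the span of \<open>G\<close> the correction is zero,
      and for \<open>g\<close> it equals the whole error \<open>g'\<close>.\<close>
    have sum_e': "(\<Sum>a<Suc r. h (b' a) * e' a x)
        = (\<Sum>a<r. h (b a) * e a x) + (h z - (\<Sum>a<r. h (b a) * e a z)) * n x" for h x
      by (simp add: e'_def b'_def fscale_def algebra_simps sum_subtractf sum_distrib_left)
    have "h x = (\<Sum>a<Suc r. h (b' a) * e' a x)" if "h \<in> fn.span (insert g G)" for h x
    proof -
      from *[OF that] obtain c h0 where h0: "h0 \<in> fn.span G" and hh: "h = fscale c g + h0" by blast
      have "g x = (\<Sum>a<Suc r. g (b' a) * e' a x)"
        unfolding sum_e' using g'x[of x] g'x[of z] z by (simp add: nx)
      moreover have "h0 x = (\<Sum>a<Suc r. h0 (b' a) * e' a x)"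
        unfolding sum_e' using h[OF h0, of x] h[OF h0, of z] by simp
      ultimately show ?thesis
        by (simp add: hh fscale_def distrib_right sum.distrib mult.assoc flip: sum_distrib_left
            del: sum.lessThan_Suc)
    qed
    moreover have "e' a \<in> fn.span (insert g G)" if "a < Suc r" for a
      using eb(1) mono n_span by (auto simp: e'_def intro!: fn.span_diff fn.span_scale)
    moreover have "\<exists>h\<in>fn.span (insert g G). h (b' a) \<noteq> 0" if "a < Suc r" for a
      using eb(2) mono z g'_span by (auto simp: b'_def)
    ultimately show ?thesis
      by (intro exI[of _ "Suc r"] exI[of _ e'] exI[of _ b']) simp
  qed
qed

text \<open>Induction on the number of arguments. Expanding in the first argument leaves the
  functions \<open>F (b a # _)\<close> of the remaining ones. They inherit the assumption at the
  later positions, because it holds for every list and hence for those that start with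
  \<open>b a\<close>. \<open>D i\<close> stands for the dual of the factor at position
  \<open>i\<close>, and \<open>L\<close> lists the summands as coefficients with their
  factors.\<close>

lemma decompose_by_positions:
  fixes F :: "'b list \<Rightarrow> 'k::field"
  assumes "\<And>i. i < length As \<Longrightarrow> \<exists>(r::nat) e b. (\<forall>a<r. e a \<in> D i \<and> b a \<in> As ! i) \<and>
      (\<forall>Bs\<in>listset As. F Bs = (\<Sum>a<r. F (Bs[i := b a]) * e a (Bs ! i)))"
  shows "\<exists>L. (\<forall>(c, g)\<in>set L. \<forall>i<length As. g i \<in> D i) \<and>
    (\<forall>Bs\<in>listset As. F Bs = (\<Sum>(c, g)\<leftarrow>L. c * (\<Prod>i<length As. g i (Bs ! i))))"
  using assms
proof (induction As arbitrary: F D)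
  case Nil
  \<comment> \<open>With no arguments the product is empty, so one summand with the constant
    \<open>F []\<close> as coefficient suffices.\<close>
  show ?case by (rule exI[of _ "[(F [], undefined)]"]) simp
next
  case (Cons A As)
  from Cons.prems[of 0] obtain r :: nat and e b where
    eb: "\<And>a. a < r \<Longrightarrow> e a \<in> D 0 \<and> b a \<in> A"
    and F0: "\<forall>Bs\<in>listset (A # As). F Bs = (\<Sum>a<r. F (Bs[0 := b a]) * e a (Bs ! 0))"
    by auto
  have F: "F (B # Bs) = (\<Sum>a<r. F (b a # Bs) * e a B)" if "B \<in> A" "Bs \<in> listset As" for B Bs
    using F0[rule_format, of "B # Bs"] that by (simp add: set_Cons_def)
  define Q where "Q a L \<longleftrightarrow> (\<forall>(c, g)\<in>set L. \<forall>i<length As. g i \<in> D (Suc i)) \<and>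
    (\<forall>Bs\<in>listset As. F (b a # Bs) = (\<Sum>(c, g)\<leftarrow>L. c * (\<Prod>i<length As. g i (Bs ! i))))" for a L
  have "\<exists>L. Q a L" if "a < r" for a
    unfolding Q_def
  proof (rule Cons.IH)
    fix i assume "i < length As"
    with Cons.prems[of "Suc i"] obtain r' :: nat and e' b' where
      eb': "\<forall>a<r'. e' a \<in> D (Suc i) \<and> b' a \<in> As ! i"
      and *: "\<forall>Bs\<in>listset (A # As).
         F Bs = (\<Sum>a<r'. F (Bs[Suc i := b' a]) * e' a (Bs ! Suc i))"
      by auto
    have "F (b a # Bs) = (\<Sum>a'<r'. F (b a # Bs[i := b' a']) * e' a' (Bs ! i))"
      if "Bs \<in> listset As" for Bs
      using *[rule_format, of "b a # Bs"] that eb[OF \<open>a < r\<close>] by (simp add: set_Cons_def)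
    with eb' show "\<exists>(r'::nat) e' b'. (\<forall>a'<r'. e' a' \<in> D (Suc i) \<and> b' a' \<in> As ! i) \<and>
      (\<forall>Bs\<in>listset As. F (b a # Bs) = (\<Sum>a'<r'. F (b a # Bs[i := b' a']) * e' a' (Bs ! i)))"
      by (intro exI[of _ r'] exI[of _ e'] exI[of _ b']) simp
  qed
  then obtain L where Q: "\<And>a. a < r \<Longrightarrow> Q a (L a)"
    by metis
  have L: "g i \<in> D (Suc i)" if "a < r" "(c, g) \<in> set (L a)" "i < length As" for a c g i
    using Q[OF that(1)] that(2,3) by (auto simp: Q_def)
  have FL: "F (b a # Bs) = (\<Sum>(c, g)\<leftarrow>L a. c * (\<Prod>i<length As. g i (Bs ! i)))"
    if "a < r" "Bs \<in> listset As" for a Bs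
    using Q[OF that(1)] that(2) by (simp add: Q_def)
  \<comment> \<open>Each summand for \<open>F (b a # _)\<close> receives \<open>e a\<close> as its
    factor at position 0; \<open>case_nat\<close> shifts its other factors by one.\<close>
  define M where "M = concat (map (\<lambda>a. map (\<lambda>(c, g). (c, case_nat (e a) g)) (L a)) [0..<r])"
  have "\<forall>(c, g)\<in>set M. \<forall>i<length (A # As). g i \<in> D i"
    using eb L by (auto simp: M_def less_Suc_eq_0_disj)
  moreover have "F (B # Bs) = (\<Sum>(c, g)\<leftarrow>M. c * (\<Prod>i<length (A # As). g i ((B # Bs) ! i)))"
    if "B \<in> A" "Bs \<in> listset As" for B Bs
  proof -
    have "(\<Sum>(c, g)\<leftarrow>M. c * (\<Prod>i<length (A # As). g i ((B # Bs) ! i)))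
        = (\<Sum>a\<leftarrow>[0..<r]. \<Sum>(c, g)\<leftarrow>L a. c * (\<Prod>i<length As. g i (Bs ! i)) * e a B)"
      unfolding M_def
      by (induction r)
        (simp_all add: case_prod_unfold comp_def prod.lessThan_Suc_shift mult_ac del: prod.lessThan_Suc)
    also have "\<dots> = (\<Sum>a\<leftarrow>[0..<r]. F (b a # Bs) * e a B)"
      using FL that by (intro arg_cong[where f = sum_list] map_cong)
        (auto simp: case_prod_unfold sum_list_mult_const)
    finally show ?thesis
      using F[OF that] by (simp add: interv_sum_list_conv_sum_set_nat lessThan_atLeast0)
  qed
  ultimately show ?case
    by (intro exI[of _ M]) (auto simp: set_Cons_def simp del: prod.lessThan_Suc)
qed

text \<open>\<open>recursive\<close> asks for a finite set that spans the translations exactly,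
  whereas a bound from above only places them inside a finite span. A maximal independent subset of
  \<open>T\<close> closes the gap: independence inside a finite span makes it finite.\<close>

lemma span_eq_span_finite:
  assumes "T \<subseteq> fn.span G" "finite G"
  shows "\<exists>H. finite H \<and> fn.span T = fn.span H"
proof -
  obtain H where H: "H \<subseteq> T" "fn.independent H" "T \<subseteq> fn.span H"
    using fn.maximal_independent_subset by blast
  then have "finite H"
    using fn.independent_span_bound[OF assms(2) H(2)] assms(1) by auto
  moreover have "fn.span T = fn.span H"
    using H by (meson fn.span_mono fn.span_minimal fn.subspace_span equalityI)
  ultimately show ?thesis by blast
qed

section \<open>Permuting a single block\<close>

text \<open>The explicit form of \<open>sum_perm\<close> when \<open>\<sigma>\<close> acts on one
  block, of length \<open>k\<close> and starting at \<open>a\<close>, and all other blocks stay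
  fixed. In this form its inversions can be read off.\<close>

definition perm_shift :: "nat \<Rightarrow> nat \<Rightarrow> (nat \<Rightarrow> nat) \<Rightarrow> nat \<Rightarrow> nat" where
  "perm_shift a k \<sigma> t = (if a \<le> t \<and> t < a + k then a + \<sigma> (t - a) else t)"

lemma perm_shift_permutes:
  assumes "\<sigma> permutes {..<k}" "a + k \<le> n"
  shows "perm_shift a k \<sigma> permutes {..<n}"
proof (rule bij_imp_permutes)
  have lt: "\<sigma> j < k \<longleftrightarrow> j < k" for j
    using permutes_in_image[OF assms(1), of j] by simp
  have "inj_on (perm_shift a k \<sigma>) {..<n}"
  proof (rule inj_onI)
    fix s t assume *: "perm_shift a k \<sigma> s = perm_shift a k \<sigma> t"
    have "\<sigma> (s - a) = \<sigma> (t - a) \<Longrightarrow> s - a = t - a"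
      by (rule injD[OF permutes_inj[OF assms(1)]])
    with * lt[of "s - a"] lt[of "t - a"] show "s = t"
      unfolding perm_shift_def by (simp split: if_splits)
  qed
  moreover have "perm_shift a k \<sigma> ` {..<n} \<subseteq> {..<n}"
  proof clarsimp
    fix t assume "t < n"
    with assms(2) lt[of "t - a"] show "perm_shift a k \<sigma> t < n"
      by (auto simp: perm_shift_def)
  qed
  ultimately show "bij_betw (perm_shift a k \<sigma>) {..<n} {..<n}"
    by (simp add: bij_betw_def endo_inj_surj)
qed (use assms(2) in \<open>auto simp: perm_shift_def\<close>)

lemma upt_append3: "[0..<a + k + b] = [0..<a] @ [a..<a + k] @ [a + k..<a + k + b]"
  using upt_add_eq_append[of 0 "a + k" b] upt_add_eq_append[of 0 a k] by simp

lemma map_upt_append3: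
  "map h [0..<a + k + b] = map h [0..<a] @ map (\<lambda>j. h (a + j)) [0..<k] @ map h [a + k..<a + k + b]"
proof -
  have "[a..<a + k] = map (\<lambda>j. a + j) [0..<k]"
    by (rule nth_equalityI) auto
  then show ?thesis
    by (simp add: upt_append3 comp_def)
qed

lemma permute_list_perm_shift:
  assumes "\<sigma> permutes {..<length ys}"
  shows "permute_list (perm_shift (length xs) (length ys) \<sigma>) (xs @ ys @ zs) = xs @ permute_list \<sigma> ys @ zs"
proof -
  have lt: "\<sigma> j < length ys \<longleftrightarrow> j < length ys" for j
    using permutes_in_image[OF assms, of j] by simp
  have "length (xs @ ys @ zs) = length xs + length ys + length zs" by simp
  then show ?thesis
    unfolding permute_list_def by (simp only: map_upt_append3)
      (intro arg_cong2[where f = "(@)"] nth_equalityI, auto simp: perm_shift_def lt nth_append)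
qed

text \<open>Positions outside the block are fixed and the block is mapped to itself, so both members
  of an inversion lie in the block. Translation by the length of \<open>cs\<close> therefore matches
  the inversions of \<open>\<sigma>\<close> with those of the shifted permutation, and the degrees
  involved agree.\<close>

lemma koszul_perm_shift:
  assumes \<sigma>: "\<sigma> permutes {..<length ds}"
  shows "koszul (perm_shift (length cs) (length ds) \<sigma>) (cs @ ds @ es) = (koszul \<sigma> ds :: 'k::field)"
proof -
  let ?a = "length cs" and ?k = "length ds"
  let ?\<tau> = "perm_shift ?a ?k \<sigma>" and ?ds = "cs @ ds @ es"
  have lt: "\<sigma> j < ?k \<longleftrightarrow> j < ?k" for j
    using permutes_in_image[OF \<sigma>, of j] by simp
  have "bij_betw (\<lambda>(i, j). (?a + i, ?a + j)) {(i, j). i < j \<and> j < ?k \<and> \<sigma> j < \<sigma> i}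
      {(i, j). i < j \<and> j < length ?ds \<and> ?\<tau> j < ?\<tau> i}"
    unfolding bij_betw_def
  proof (intro conjI equalityI subsetI)
    show "inj_on (\<lambda>(i, j). (?a + i, ?a + j)) {(i, j). i < j \<and> j < ?k \<and> \<sigma> j < \<sigma> i}"
      by (auto simp: inj_on_def)
    fix p assume "p \<in> {(i, j). i < j \<and> j < length ?ds \<and> ?\<tau> j < ?\<tau> i}"
    then obtain i j where p: "p = (i, j)" "i < j" "?\<tau> j < ?\<tau> i" by auto
    then have "?a \<le> i \<and> i < ?a + ?k \<and> ?a \<le> j \<and> j < ?a + ?k"
      using lt[of "i - ?a"] lt[of "j - ?a"] by (auto simp: perm_shift_def split: if_splits)
    with p show "p \<in> (\<lambda>(i, j). (?a + i, ?a + j)) ` {(i, j). i < j \<and> j < ?k \<and> \<sigma> j < \<sigma> i}"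
      by (intro image_eqI[of _ _ "(i - ?a, j - ?a)"]) (auto simp: perm_shift_def)
  qed (auto simp: perm_shift_def)
  then have "(\<Sum>(i, j)\<in>{(i, j). i < j \<and> j < length ?ds \<and> ?\<tau> j < ?\<tau> i}. ?ds ! ?\<tau> i * ?ds ! ?\<tau> j)
      = (\<Sum>(i, j)\<in>{(i, j). i < j \<and> j < ?k \<and> \<sigma> j < \<sigma> i}.
           ?ds ! ?\<tau> (?a + i) * ?ds ! ?\<tau> (?a + j))"
    by (subst sum.reindex_bij_betw[symmetric]) (auto simp: case_prod_unfold)
  also have "\<dots> = (\<Sum>(i, j)\<in>{(i, j). i < j \<and> j < ?k \<and> \<sigma> j < \<sigma> i}. ds ! \<sigma> i * ds ! \<sigma> j)"
    by (intro sum.cong refl) (auto simp: perm_shift_def nth_append lt)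
  finally show ?thesis
    by (simp only: koszul_def)
qed

section \<open>Block permutations that move a single block\<close>

lemma concat_map_upt:
  assumes "mono S" "i \<le> j"
  shows "concat (map (\<lambda>i. [S i..<S (Suc i)]) [i..<j]) = [S i..<(S j :: nat)]"
  using assms(2)
proof (induction j rule: dec_induct)
  case (step j)
  have "S i \<le> S j" "S j \<le> S (Suc j)"
    using step monoD[OF assms(1)] by auto
  then show ?case
    using step upt_add_eq_append[of "S i" "S j" "S (Suc j) - S j"] by simp
qed simp

lemma mono_sum_list_take: "mono (\<lambda>i. sum_list (take i (ks :: nat list)))"
proof (rule monoI)
  fix i j :: nat assume "i \<le> j"
  then have "take j ks = take i ks @ take (j - i) (drop i ks)"
    by (metis le_add_diff_inverse take_add)
  then show "sum_list (take i ks) \<le> sum_list (take j ks)" by simp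
qed

text \<open>Cuts out the one block that moves. Of the blocks before and after it only the number and
  the concatenation are recorded, since identities act on them.\<close>

lemma blocks_split:
  "\<exists>bs cs. blocks (ks @ k # ls) = bs @ [sum_list ks..<sum_list ks + k] # cs \<and>
     length bs = length ks \<and> length cs = length ls \<and>
     concat bs = [0..<sum_list ks] \<and> concat cs = [sum_list ks + k..<sum_list ks + k + sum_list ls]"
proof -
  define S where "S i = sum_list (take i (ks @ k # ls))" for i
  have "mono S"
    unfolding S_def by (rule mono_sum_list_take)
  have "[0..<length (ks @ k # ls)] = [0..<length ks] @ length ks # [Suc (length ks)..<length (ks @ k # ls)]"
    using upt_add_eq_append[of 0 "length ks" "Suc (length ls)"]
    by (simp add: upt_conv_Cons del: upt_Suc)
  then have "blocks (ks @ k # ls) =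
      map (\<lambda>i. [S i..<S (Suc i)]) [0..<length ks] @ [S (length ks)..<S (Suc (length ks))] #
      map (\<lambda>i. [S i..<S (Suc i)]) [Suc (length ks)..<length (ks @ k # ls)]"
    by (simp add: blocks_def S_def del: length_append)
  moreover have "S 0 = 0" "S (length ks) = sum_list ks" "S (Suc (length ks)) = sum_list ks + k"
    "S (length (ks @ k # ls)) = sum_list ks + k + sum_list ls"
    by (simp_all add: S_def)
  moreover have "concat (map (\<lambda>i. [S i..<S (Suc i)]) [0..<length ks]) = [S 0..<S (length ks)]"
    by (rule concat_map_upt[OF \<open>mono S\<close>]) simp
  moreover have "concat (map (\<lambda>i. [S i..<S (Suc i)]) [Suc (length ks)..<length (ks @ k # ls)])
      = [S (Suc (length ks))..<S (length (ks @ k # ls))]"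
    by (rule concat_map_upt[OF \<open>mono S\<close>]) simp
  ultimately show ?thesis
    by (intro exI conjI) (auto simp: Suc_le_eq)
qed

lemma map2_permute_list_id: "n = length xss \<Longrightarrow> map2 permute_list (replicate n id) xss = xss"
  by (induction xss arbitrary: n) auto

text \<open>Both sides are compared as rearrangements of the interval of all positions: permuting
  that interval by a permutation lists the values of the permutation. Beyond the last block both
  sides are the identity.\<close>

lemma sum_perm_one_block:
  assumes \<sigma>: "\<sigma> permutes {..<k}"
  shows "sum_perm (replicate (length ks) id @ \<sigma> # replicate (length ls) id) (ks @ k # ls)
           = perm_shift (sum_list ks) k \<sigma>"
proof
  fix t
  obtain bs cs where blk: "blocks (ks @ k # ls) = bs @ [sum_list ks..<sum_list ks + k] # cs"
    "length bs = length ks" "length cs = length ls"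
    "concat bs = [0..<sum_list ks]" "concat cs = [sum_list ks + k..<sum_list ks + k + sum_list ls]"
    using blocks_split by blast
  have "concat (map2 permute_list (replicate (length ks) id @ \<sigma> # replicate (length ls) id)
      (blocks (ks @ k # ls)))
    = [0..<sum_list ks] @ permute_list \<sigma> [sum_list ks..<sum_list ks + k] @
      [sum_list ks + k..<sum_list ks + k + sum_list ls]"
    using blk by (simp add: map2_permute_list_id)
  also have "\<dots> = permute_list (perm_shift (sum_list ks) k \<sigma>)
      ([0..<sum_list ks] @ [sum_list ks..<sum_list ks + k] @
       [sum_list ks + k..<sum_list ks + k + sum_list ls])"
    using permute_list_perm_shift[of \<sigma> "[sum_list ks..<sum_list ks + k]" "[0..<sum_list ks]"
        "[sum_list ks + k..<sum_list ks + k + sum_list ls]"] \<sigma> by simp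
  also have "\<dots> = permute_list (perm_shift (sum_list ks) k \<sigma>) [0..<sum_list ks + k + sum_list ls]"
    by (simp only: upt_append3)
  finally have *: "concat (map2 permute_list (replicate (length ks) id @ \<sigma> # replicate (length ls) id)
      (blocks (ks @ k # ls)))
    = permute_list (perm_shift (sum_list ks) k \<sigma>) [0..<sum_list ks + k + sum_list ls]" .
  have perm: "perm_shift (sum_list ks) k \<sigma> permutes {..<sum_list ks + k + sum_list ls}"
    by (rule perm_shift_permutes[OF \<sigma>]) simp
  show "sum_perm (replicate (length ks) id @ \<sigma> # replicate (length ls) id) (ks @ k # ls) t
      = perm_shift (sum_list ks) k \<sigma> t"
  proof (cases "t < sum_list ks + k + sum_list ls")
    case True
    then show ?thesis
      using permutes_in_image[OF perm, of t]
      by (simp add: sum_perm_def * permute_list_nth perm del: upt_Suc)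
  next
    case False
    then show ?thesis
      by (simp add: sum_perm_def perm_shift_def)
  qed
qed

section \<open>Grafting relators\<close>

lemma pscale_single: "pscale c (Poly_Mapping.single g d) = Poly_Mapping.single g (c * d)"
  by (rule poly_mapping_eqI) (simp add: lookup_pscale lookup_single when_def)

definition lin_ext :: "('g \<Rightarrow> ('h \<Rightarrow>\<^sub>0 'k)) \<Rightarrow> ('g \<Rightarrow>\<^sub>0 'k::field) \<Rightarrow> ('h \<Rightarrow>\<^sub>0 'k)" where
  "lin_ext \<psi> u = (\<Sum>g\<in>Poly_Mapping.keys u. pscale (Poly_Mapping.lookup u g) (\<psi> g))"

text \<open>Lets vectors with different supports be summed over a common finite set, which is what
  additivity requires.\<close>

lemma lin_ext_superset:
  assumes "finite K" "Poly_Mapping.keys u \<subseteq> K"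
  shows "lin_ext \<psi> u = (\<Sum>g\<in>K. pscale (Poly_Mapping.lookup u g) (\<psi> g))"
  unfolding lin_ext_def
  using assms by (intro sum.mono_neutral_left) (auto simp: in_keys_iff)

lemma lin_ext_add: "lin_ext \<psi> (u + v) = lin_ext \<psi> u + lin_ext \<psi> v"
proof -
  let ?K = "Poly_Mapping.keys u \<union> Poly_Mapping.keys v"
  have "lin_ext \<psi> w = (\<Sum>g\<in>?K. pscale (Poly_Mapping.lookup w g) (\<psi> g))"
    if "w \<in> {u, v, u + v}" for w
    using that keys_add[of u v] by (intro lin_ext_superset) auto
  then show ?thesis
    by (simp add: lookup_add pm.scale_left_distrib sum.distrib)
qed

lemma lin_ext_pscale: "lin_ext \<psi> (pscale c u) = pscale c (lin_ext \<psi> u)"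
proof -
  have "lin_ext \<psi> (pscale c u)
      = (\<Sum>g\<in>Poly_Mapping.keys u. pscale (Poly_Mapping.lookup (pscale c u) g) (\<psi> g))"
    by (rule lin_ext_superset) (auto simp: in_keys_iff lookup_pscale)
  then show ?thesis
    by (simp add: lin_ext_def lookup_pscale pm.scale_sum_right)
qed

lemma lin_ext_diff: "lin_ext \<psi> (u - v) = lin_ext \<psi> u - lin_ext \<psi> v"
  using lin_ext_add[of \<psi> "u - v" v] by simp

lemma lin_ext_gen: "lin_ext \<psi> (Poly_Mapping.single g 1) = \<psi> g"
  by (simp add: lin_ext_def)

text \<open>Expanding every entry except \<open>u\<close> into corollas exhibits the action as a
  linear combination of linear maps in \<open>u\<close>, each of which grafts \<open>u\<close>
  between fixed corollas. Linearity in one entry and compatibility with the relations both reduce to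
  these maps.\<close>

lemma act_Free_split:
  "act_Free P m (us @ u # vs) =
     (\<Sum>(gs, hs)\<in>listset (map Poly_Mapping.keys us) \<times> listset (map Poly_Mapping.keys vs).
        pscale (prod_list (map2 Poly_Mapping.lookup us gs) * prod_list (map2 Poly_Mapping.lookup vs hs))
          (lin_ext (\<lambda>g. Poly_Mapping.single (graft P m (gs @ g # hs)) (graft_sgn (gs @ g # hs))) u))"
proof -
  let ?A = "listset (map Poly_Mapping.keys us)" and ?B = "listset (map Poly_Mapping.keys vs)"
  let ?s = "\<lambda>gs. Poly_Mapping.single (graft P m gs)
              (graft_sgn gs * prod_list (map2 Poly_Mapping.lookup (us @ u # vs) gs))"
  have "act_Free P m (us @ u # vs) = (\<Sum>gs\<in>listset (map Poly_Mapping.keys us @ Poly_Mapping.keys u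
      # map Poly_Mapping.keys vs). ?s gs)"
    by (simp add: act_Free_def)
  also have "\<dots> = (\<Sum>(gs, g, hs)\<in>?A \<times> Poly_Mapping.keys u \<times> ?B. ?s (gs @ g # hs))"
    by (subst sum.reindex_bij_betw[OF bij_betw_listset_split, symmetric])
      (simp add: case_prod_unfold)
  also have "\<dots> = (\<Sum>gs\<in>?A. \<Sum>g\<in>Poly_Mapping.keys u. \<Sum>hs\<in>?B. ?s (gs @ g # hs))"
    by (simp add: sum.cartesian_product)
  \<comment> \<open>The sum over the support of \<open>u\<close> is moved innermost, where it
    becomes a \<open>lin_ext\<close>.\<close>
  also have "\<dots> = (\<Sum>gs\<in>?A. \<Sum>hs\<in>?B. \<Sum>g\<in>Poly_Mapping.keys u. ?s (gs @ g # hs))"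
    by (intro sum.cong refl sum.swap)
  also have "\<dots> = (\<Sum>(gs, hs)\<in>?A \<times> ?B. \<Sum>g\<in>Poly_Mapping.keys u. ?s (gs @ g # hs))"
    by (rule sum.cartesian_product)
  also have "\<dots> = (\<Sum>(gs, hs)\<in>?A \<times> ?B.
        pscale (prod_list (map2 Poly_Mapping.lookup us gs) * prod_list (map2 Poly_Mapping.lookup vs hs))
          (lin_ext (\<lambda>g. Poly_Mapping.single (graft P m (gs @ g # hs)) (graft_sgn (gs @ g # hs))) u))"
  proof (intro sum.cong refl, clarify)
    fix gs hs assume "gs \<in> ?A" "hs \<in> ?B"
    then have "length us = length gs" "length vs = length hs"
      by (auto simp: mem_listset_conv_nth)
    then show "(\<Sum>g\<in>Poly_Mapping.keys u. ?s (gs @ g # hs)) =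
        pscale (prod_list (map2 Poly_Mapping.lookup us gs) * prod_list (map2 Poly_Mapping.lookup vs hs))
          (lin_ext (\<lambda>g. Poly_Mapping.single (graft P m (gs @ g # hs)) (graft_sgn (gs @ g # hs))) u)"
      by (auto simp: lin_ext_def pm.scale_sum_right pscale_single mult_ac intro!: sum.cong)
  qed
  finally show ?thesis .
qed

lemma act_Free_add:
  "act_Free P m (us @ (u + v) # vs) = act_Free P m (us @ u # vs) + act_Free P m (us @ v # vs)"
  unfolding act_Free_split
  by (simp add: lin_ext_add pm.scale_right_distrib sum.distrib case_prod_unfold)

lemma act_Free_pscale:
  "act_Free P m (us @ pscale c u # vs) = pscale c (act_Free P m (us @ u # vs))"
  unfolding act_Free_split
  by (simp add: lin_ext_pscale pm.scale_sum_right mult.commute case_prod_unfold)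

lemma act_Free_diff:
  "act_Free P m (us @ (u - v) # vs) = act_Free P m (us @ u # vs) - act_Free P m (us @ v # vs)"
  using act_Free_add[of P m us "u - v" v vs] by simp

lemma list_update_middle: "i = length xs \<Longrightarrow> (xs @ y # ys)[i := z] = xs @ z # ys"
  by simp

section \<open>Colours, signs and degrees of grafted corollas\<close>

lemma corollas_list_all2:
  "g \<in> corollas P A x \<Longrightarrow>
     list_all2 (\<lambda>x (d, a). a \<in> piece (A x) d) (inp (root g)) (leaves g)"
  by (simp add: corollas_def)

lemma listset_corollas_leaves:
  "gs \<in> listset (map (corollas P A) xs) \<Longrightarrow>
     list_all2 (\<lambda>x (d, a). a \<in> piece (A x) d) (concat (map (inp \<circ> root) gs)) (concat (map leaves gs))"
  by (induction xs arbitrary: gs)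
    (auto simp: set_Cons_def intro!: list_all2_appendI corollas_list_all2)

lemma listset_corollas_roots:
  "gs \<in> listset (map (corollas P A) xs) \<Longrightarrow> set (map root gs) \<subseteq> Ops P \<and> map out (map root gs) = xs"
  by (induction xs arbitrary: gs) (fastforce simp: set_Cons_def corollas_def)+

text \<open>The sign sees a corolla only through the degree of its root and the total degree of its
  leaves. All corollas in one relator agree in both, so the sign factors out of a grafted
  relator.\<close>

lemma graft_sgn_cong:
  "\<lbrakk>deg (root g) = deg (root h); sum_list (map fst (leaves g)) = sum_list (map fst (leaves h))\<rbrakk> \<Longrightarrow>
     graft_sgn (gs @ g # hs) = graft_sgn (gs @ h # hs)"
  by (simp add: graft_sgn_def)

lemma cdeg_graft: "cdeg (graft P m gs) = deg m + sum_list (map cdeg gs)"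
  by (induction gs) (simp_all add: cdeg_def graft_def comp_op_def)

context symmetric_operad
begin

lemma composable_roots:
  "\<lbrakk>m \<in> Ops P; gs \<in> listset (map (corollas P A) (inp m))\<rbrakk> \<Longrightarrow> composable P m (map root gs)"
  using listset_corollas_roots[of gs P A "inp m"] by (simp add: composable_def)

lemma graft_in_corollas:
  "\<lbrakk>m \<in> Ops P; gs \<in> listset (map (corollas P A) (inp m))\<rbrakk> \<Longrightarrow> graft P m gs \<in> corollas P A (out m)"
  using comp_op[OF composable_roots] listset_corollas_leaves
  by (auto simp: corollas_def graft_def comp_op_def)

section \<open>Grafting a relator between fixed corollas\<close>

context
  fixes A :: "'x \<Rightarrow> ('k, 'a::ab_group_add) complex" and m xs x ys gs hs
  assumes m: "m \<in> Ops P" and inp_m: "inp m = xs @ x # ys"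
    and gs: "gs \<in> listset (map (corollas P A) xs)" and hs: "hs \<in> listset (map (corollas P A) ys)"
begin

lemma insert_corolla:
  assumes "g \<in> corollas P A x"
  shows "gs @ g # hs \<in> listset (map (corollas P A) (inp m))"
  using assms gs hs by (auto simp: inp_m mem_listset_iff intro!: list_all2_appendI)

lemma composable_insert:
  assumes "g \<in> corollas P A x"
  shows "composable P m (map root gs @ root g # map root hs)"
  using composable_roots[OF m insert_corolla[OF assms]] by simp

text \<open>Composition is linear in each inner operation, so linearity in the root \<open>n\<close>
  turns into linearity in the composite root.\<close>

lemma graft_linear_root_relator:
  assumes g: "\<lparr>root = n, leaves = ls\<rparr> \<in> corollas P A x" and u: "n\<lparr>vec := u\<rparr> \<in> Ops P"
  shows "gen (graft P m (gs @ \<lparr>root = n\<lparr>vec := osc P n c (vec n) + u\<rparr>, leaves = ls\<rparr> # hs))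
      - (pscale c (gen (graft P m (gs @ \<lparr>root = n, leaves = ls\<rparr> # hs)))
         + gen (graft P m (gs @ \<lparr>root = n\<lparr>vec := u\<rparr>, leaves = ls\<rparr> # hs)))
      \<in> relators P A (out m)"
proof -
  let ?ns = "\<lambda>n. map root gs @ n # map root hs"
  let ?ls = "concat (map leaves (gs @ \<lparr>root = n, leaves = ls\<rparr> # hs))"
  have comp: "composable P m (?ns n)"
    using composable_insert[OF g] by simp
  have g_u: "\<lparr>root = n\<lparr>vec := u\<rparr>, leaves = ls\<rparr> \<in> corollas P A x"
    using g u by (simp add: corollas_def)
  have graft: "graft P m (gs @ \<lparr>root = n', leaves = ls\<rparr> # hs) = \<lparr>root = comp_op P m (?ns n'), leaves = ?ls\<rparr>"
    for n' by (simp add: graft_def)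
  have comp_op_vec: "comp_op P m (?ns (n\<lparr>vec := w\<rparr>)) = (comp_op P m (?ns n))\<lparr>vec := gamma P m (?ns (n\<lparr>vec := w\<rparr>))\<rparr>"
    for w by (simp add: comp_op_def)
  \<comment> \<open>Linearity of the composition in its inner operation at position
    \<open>length gs\<close>, the place of \<open>n\<close>.\<close>
  have "gamma P m (?ns (n\<lparr>vec := osc P n c (vec n) + u\<rparr>)) =
      osc P (comp_op P m (?ns n)) c (vec (comp_op P m (?ns n))) + gamma P m (?ns (n\<lparr>vec := u\<rparr>))"
    using gamma_linear_leaf[OF comp, of "length gs" n u c] u
    by (simp add: list_update_middle nth_append comp_op_def)
  moreover have "gen \<lparr>root = (comp_op P m (?ns n))\<lparr>vec := osc P (comp_op P m (?ns n)) c
         (vec (comp_op P m (?ns n))) + gamma P m (?ns (n\<lparr>vec := u\<rparr>))\<rparr>, leaves = ?ls\<rparr>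
       - (pscale c (gen \<lparr>root = comp_op P m (?ns n), leaves = ?ls\<rparr>)
          + gen \<lparr>root = (comp_op P m (?ns n))\<lparr>vec := gamma P m (?ns (n\<lparr>vec := u\<rparr>))\<rparr>, leaves = ?ls\<rparr>)
     \<in> relators P A (out m)"
  proof (rule relators.linear_root)
    show "\<lparr>root = comp_op P m (?ns n), leaves = ?ls\<rparr> \<in> corollas P A (out m)"
      using graft_in_corollas[OF m insert_corolla[OF g]] by (simp only: graft)
    show "(comp_op P m (?ns n))\<lparr>vec := gamma P m (?ns (n\<lparr>vec := u\<rparr>))\<rparr> \<in> Ops P"
      using comp_op[OF composable_insert[OF g_u]] comp_op_vec by simp
  qed
  ultimately show ?thesis
    by (simp only: graft comp_op_vec)
qed

text \<open>Grafting leaves the leaves unchanged and concatenates them, so the relation reappears at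
  a leaf index shifted by the number of leaves of \<open>gs\<close>.\<close>

lemma graft_linear_leaf_relator:
  assumes g: "\<lparr>root = n, leaves = ls\<rparr> \<in> corollas P A x" and i: "i < length ls" "ls ! i = (d, a)"
    and b: "b \<in> piece (A (inp n ! i)) d"
  shows "gen (graft P m (gs @ \<lparr>root = n, leaves = ls[i := (d, scale (A (inp n ! i)) c a + b)]\<rparr> # hs))
      - (pscale c (gen (graft P m (gs @ \<lparr>root = n, leaves = ls\<rparr> # hs)))
         + gen (graft P m (gs @ \<lparr>root = n, leaves = ls[i := (d, b)]\<rparr> # hs)))
      \<in> relators P A (out m)"
proof -
  let ?n = "comp_op P m (map root gs @ n # map root hs)"
  let ?pre = "concat (map leaves gs)" and ?post = "concat (map leaves hs)"
  let ?i = "length ?pre + i"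
  \<comment> \<open>In a corolla the inputs and the leaves are equally many, so the shifted index
    also finds the same colour among the inputs of the composite.\<close>
  have len: "length (concat (map (inp \<circ> root) gs)) = length ?pre" "length (inp n) = length ls"
    using listset_corollas_leaves[OF gs] corollas_list_all2[OF g] by (auto dest: list_all2_lengthD)
  then have inp: "inp ?n ! ?i = inp n ! i"
    using i by (simp add: comp_op_def nth_append comp_def del: length_concat)
  have graft: "graft P m (gs @ \<lparr>root = n, leaves = ls'\<rparr> # hs) = \<lparr>root = ?n, leaves = ?pre @ ls' @ ?post\<rparr>"
    for ls' by (simp add: graft_def)
  have upd: "?pre @ ls[i := e] @ ?post = (?pre @ ls @ ?post)[?i := e]" for e
    using i by (simp add: list_update_append del: length_concat)
  have "gen \<lparr>root = ?n, leaves = (?pre @ ls @ ?post)[?i := (d, scale (A (inp ?n ! ?i)) c a + b)]\<rparr>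
      - (pscale c (gen \<lparr>root = ?n, leaves = ?pre @ ls @ ?post\<rparr>)
         + gen \<lparr>root = ?n, leaves = (?pre @ ls @ ?post)[?i := (d, b)]\<rparr>)
      \<in> relators P A (out m)"
  proof (rule relators.linear_leaf)
    show "\<lparr>root = ?n, leaves = ?pre @ ls @ ?post\<rparr> \<in> corollas P A (out m)"
      using graft_in_corollas[OF m insert_corolla[OF g]] by (simp only: graft)
    show "?i < length (?pre @ ls @ ?post)" "(?pre @ ls @ ?post) ! ?i = (d, a)"
      using i by (simp_all add: nth_append del: length_concat)
    show "b \<in> piece (A (inp ?n ! ?i)) d"
      using b by (simp only: inp)
  qed
  then show ?thesis
    by (simp only: graft inp upd)
qed

text \<open>Equivariance is only needed for \<open>\<sigma>\<close> acting inside one block and the identity on the others.\<close>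

lemma graft_symmetry_relator:
  assumes g: "\<lparr>root = n, leaves = ls\<rparr> \<in> corollas P A x" and \<sigma>: "\<sigma> permutes {..<length ls}"
  shows "pscale (koszul \<sigma> (map fst ls))
        (gen (graft P m (gs @ \<lparr>root = act_op P n \<sigma>, leaves = permute_list \<sigma> ls\<rparr> # hs)))
      - gen (graft P m (gs @ \<lparr>root = n, leaves = ls\<rparr> # hs))
      \<in> relators P A (out m)"
proof -
  let ?ns = "\<lambda>n. map root gs @ n # map root hs"
  let ?pre = "concat (map leaves gs)" and ?post = "concat (map leaves hs)"
  let ?\<tau> = "perm_shift (length ?pre) (length ls) \<sigma>"
  let ?ks = "\<lambda>gs. map (length \<circ> inp \<circ> root) gs"
  have comp: "composable P m (?ns n)"
    using composable_insert[OF g] by simp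
  then have ops: "set (?ns n) \<subseteq> Ops P"
    by (simp add: composable_def)
  have "length (concat (map (inp \<circ> root) gs)) = length ?pre" and len: "length (inp n) = length ls"
    using listset_corollas_leaves[OF gs] corollas_list_all2[OF g] by (auto dest: list_all2_lengthD)
  then have len_pre: "length (concat (map (inp \<circ> root) gs)) = length ?pre" "sum_list (?ks gs) = length ?pre"
    by (simp_all add: length_concat comp_def)
  have act_id: "act_op P r id = r" if "r \<in> Ops P" for r
    using act_id[OF that] by (simp add: act_op_def)
  have map_act_id: "map2 (act_op P) rs (replicate (length rs) id) = rs" if "set rs \<subseteq> Ops P" for rs
    using that by (induction rs) (auto simp: act_id)
  let ?\<sigma>s = "replicate (length gs) id @ \<sigma> # replicate (length hs) id"
  have "gamma P m (map2 (act_op P) (?ns n) ?\<sigma>s)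
      = act P (comp_op P m (?ns n)) (sum_perm ?\<sigma>s (map (length \<circ> inp) (?ns n)))"
  proof (rule equivariant_inner[OF comp])
    show "(?\<sigma>s ! i) permutes {..<length (inp (?ns n ! i))}" if "i < length (?ns n)" for i
      using \<sigma> that len permutes_id[of "{..<length (inp (?ns n ! i))}"] by (auto simp: nth_append nth_Cons' id_def)
  qed simp
  moreover have "map2 (act_op P) (?ns n) ?\<sigma>s = ?ns (act_op P n \<sigma>)"
    using ops map_act_id[of "map root gs"] map_act_id[of "map root hs"] by simp
  moreover have "sum_perm ?\<sigma>s (map (length \<circ> inp) (?ns n)) = ?\<tau>"
    using sum_perm_one_block[of \<sigma> "length ls" "?ks gs" "?ks hs"] \<sigma> len len_pre by (simp add: comp_assoc)
  ultimately have gamma: "gamma P m (?ns (act_op P n \<sigma>)) = act P (comp_op P m (?ns n)) ?\<tau>"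
    by simp
  have "permute_list ?\<tau> (concat (map (inp \<circ> root) gs) @ inp n @ concat (map (inp \<circ> root) hs))
      = concat (map (inp \<circ> root) gs) @ permute_list \<sigma> (inp n) @ concat (map (inp \<circ> root) hs)"
    using permute_list_perm_shift[of \<sigma> "inp n"] \<sigma> len len_pre(1) by metis
  \<comment> \<open>Composing with the permuted operation gives the same tagged operation as
    permuting the composite by \<open>?\<tau>\<close>: the input colours agree as well as the
    vectors.\<close>
  then have root: "comp_op P m (?ns (act_op P n \<sigma>)) = act_op P (comp_op P m (?ns n)) ?\<tau>"
    using gamma by (simp add: comp_op_def act_op_def)
  have graft: "graft P m (gs @ \<lparr>root = n', leaves = ls'\<rparr> # hs)
      = \<lparr>root = comp_op P m (?ns n'), leaves = ?pre @ ls' @ ?post\<rparr>" for n' ls'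
    by (simp add: graft_def)
  have leaves: "permute_list ?\<tau> (?pre @ ls @ ?post) = ?pre @ permute_list \<sigma> ls @ ?post"
    by (rule permute_list_perm_shift[OF \<sigma>])
  have sign: "koszul ?\<tau> (map fst (?pre @ ls @ ?post)) = koszul \<sigma> (map fst ls)"
    using koszul_perm_shift[of \<sigma> "map fst ls" "map fst ?pre" "map fst ?post"] \<sigma>
    by (simp del: length_concat)
  have "pscale (koszul ?\<tau> (map fst (?pre @ ls @ ?post)))
        (gen \<lparr>root = act_op P (comp_op P m (?ns n)) ?\<tau>, leaves = permute_list ?\<tau> (?pre @ ls @ ?post)\<rparr>)
      - gen \<lparr>root = comp_op P m (?ns n), leaves = ?pre @ ls @ ?post\<rparr> \<in> relators P A (out m)"
  proof (rule relators.symmetry)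
    show "\<lparr>root = comp_op P m (?ns n), leaves = ?pre @ ls @ ?post\<rparr> \<in> corollas P A (out m)"
      using graft_in_corollas[OF m insert_corolla[OF g]] by (simp only: graft)
    show "?\<tau> permutes {..<length (?pre @ ls @ ?post)}"
      by (rule perm_shift_permutes[OF \<sigma>]) simp
  qed
  then show ?thesis
    by (simp only: graft root leaves sign)
qed

text \<open>The corollas of a relator share one grafting sign. The extended map thus sends the
  relator to this sign times the relator formed by the grafted corollas.\<close>

lemma lin_ext_graft_relator:
  assumes "r \<in> relators P A x"
  shows "lin_ext (\<lambda>g. Poly_Mapping.single (graft P m (gs @ g # hs)) (graft_sgn (gs @ g # hs))) r
           \<in> pm.span (relators P A (out m))" (is "lin_ext ?\<psi> r \<in> _")
proof -
  \<comment> \<open>Both kinds of linearity relators have the form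
    \<open>gen g' - (pscale c (gen g) + gen g'')\<close> and are treated together.\<close>
  have linear: "lin_ext ?\<psi> (gen g' - (pscale c (gen g) + gen g'')) \<in> pm.span (relators P A (out m))"
    if "gen (graft P m (gs @ g' # hs)) - (pscale c (gen (graft P m (gs @ g # hs)))
          + gen (graft P m (gs @ g'' # hs))) \<in> relators P A (out m)"
      and sgn: "(graft_sgn (gs @ g' # hs) :: 'k) = graft_sgn (gs @ g # hs)"
        "(graft_sgn (gs @ g'' # hs) :: 'k) = graft_sgn (gs @ g # hs)"
    for c g g' g''
  proof -
    have "lin_ext ?\<psi> (gen g' - (pscale c (gen g) + gen g'')) = ?\<psi> g' - (pscale c (?\<psi> g) + ?\<psi> g'')"
      by (simp only: lin_ext_diff lin_ext_add lin_ext_pscale lin_ext_gen)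
    also have "\<dots> = pscale (graft_sgn (gs @ g # hs)) (gen (graft P m (gs @ g' # hs))
        - (pscale c (gen (graft P m (gs @ g # hs))) + gen (graft P m (gs @ g'' # hs))))"
      by (simp add: sgn pscale_single pm.scale_right_distrib pm.scale_right_diff_distrib mult.commute)
    finally show ?thesis
      using that(1) by (simp add: pm.span_base pm.span_scale)
  qed
  from assms show ?thesis
  proof cases
    case (linear_root n ls u c)
    show ?thesis unfolding linear_root(1)
      by (rule linear[OF graft_linear_root_relator[OF linear_root(2,3)]];
          rule graft_sgn_cong; simp)
  next
    case (linear_leaf n ls i d a b c)
    \<comment> \<open>The replaced leaf already has degree \<open>d\<close>, so the total degree
      does not change.\<close>
    have "sum_list (map fst (ls[i := (d, e)])) = sum_list (map fst ls)" for e
      using linear_leaf(3,4) by (metis fst_conv list_update_id map_update)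
    then show ?thesis unfolding linear_leaf(1)
      by (intro linear[OF graft_linear_leaf_relator[OF linear_leaf(2-5)]] graft_sgn_cong) simp_all
  next
    case (symmetry n ls \<sigma>)
    let ?g = "\<lparr>root = n, leaves = ls\<rparr>" and ?g' = "\<lparr>root = act_op P n \<sigma>, leaves = permute_list \<sigma> ls\<rparr>"
    have "sum_list (map fst (permute_list \<sigma> ls)) = sum_list (map fst ls)"
      using symmetry(3) by (simp flip: sum_mset_sum_list)
    then have sgn: "(graft_sgn (gs @ ?g' # hs) :: 'k) = graft_sgn (gs @ ?g # hs)"
      by (intro graft_sgn_cong) (simp_all add: act_op_def)
    have "lin_ext ?\<psi> r = pscale (koszul \<sigma> (map fst ls)) (?\<psi> ?g') - ?\<psi> ?g"
      unfolding symmetry(1) by (simp only: lin_ext_diff lin_ext_pscale lin_ext_gen)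
    also have "\<dots> = pscale (graft_sgn (gs @ ?g # hs))
        (pscale (koszul \<sigma> (map fst ls)) (gen (graft P m (gs @ ?g' # hs))) - gen (graft P m (gs @ ?g # hs)))"
      by (simp add: sgn pscale_single pm.scale_right_diff_distrib mult.commute)
    finally show ?thesis
      using graft_symmetry_relator[OF symmetry(2,3)] by (simp add: pm.span_base pm.span_scale)
  qed
qed

lemma lin_ext_graft_span:
  assumes "r \<in> pm.span (relators P A x)"
  shows "lin_ext (\<lambda>g. Poly_Mapping.single (graft P m (gs @ g # hs)) (graft_sgn (gs @ g # hs))) r
           \<in> pm.span (relators P A (out m))"
  using assms
proof (induction rule: pm.span_induct)
  case base
  show ?case
    by (rule pm.subspaceI) (auto simp: lin_ext_add lin_ext_pscale pm.span_zero pm.span_add pm.span_scale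
        lin_ext_def[of _ 0])
qed (rule lin_ext_graft_relator)

end

end

section \<open>The action on classes\<close>

lemma subspace_Free: "pm.subspace (Free P A y)"
proof (rule pm.subspaceI)
  show "u + v \<in> Free P A y" if "u \<in> Free P A y" "v \<in> Free P A y" for u v
    using that keys_add[of u v] by (auto simp: Free_def)
  show "pscale c u \<in> Free P A y" if "u \<in> Free P A y" for c u
    using that by (auto simp: Free_def in_keys_iff lookup_pscale subset_iff)
qed (simp add: Free_def)

lemma mem_cls_iff:
  "v \<in> cls P A y u \<longleftrightarrow> u \<in> Free P A y \<and> v \<in> Free P A y \<and> u - v \<in> pm.span (relators P A y)"
  by (simp add: cls_def free_rel_def)

lemma cls_eqI:
  assumes "u \<in> Free P A y" "v \<in> Free P A y" "u - v \<in> pm.span (relators P A y)"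
  shows "cls P A y u = cls P A y v"
proof (rule set_eqI)
  fix w
  have "u - w \<in> pm.span (relators P A y) \<longleftrightarrow> v - w \<in> pm.span (relators P A y)"
    using pm.span_add_eq[OF assms(3), of "v - w"] by (simp add: pm.span_add_eq)
  then show "w \<in> cls P A y u \<longleftrightarrow> w \<in> cls P A y v"
    using assms(1,2) by (simp add: mem_cls_iff)
qed

lemma self_mem_cls: "u \<in> Free P A y \<Longrightarrow> u \<in> cls P A y u"
  by (simp add: mem_cls_iff pm.span_zero)

lemma cls_in_free_alg: "u \<in> Free P A y \<Longrightarrow> cls P A y u \<in> free_alg P A y"
  by (simp add: free_alg_def cls_def quotientI)

lemma free_alg_nonempty: "B \<in> free_alg P A y \<Longrightarrow> \<exists>u. u \<in> B"
  by (auto simp: free_alg_def cls_def[symmetric] elim!: quotientE) (blast intro: self_mem_cls)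

lemma free_alg_memD:
  assumes "B \<in> free_alg P A y" "u \<in> B"
  shows "u \<in> Free P A y" "v \<in> B \<Longrightarrow> u - v \<in> pm.span (relators P A y)"
proof -
  from assms(1) obtain w where B: "B = cls P A y w"
    by (auto simp: free_alg_def cls_def elim: quotientE)
  then show "u \<in> Free P A y"
    using assms(2) by (simp add: mem_cls_iff)
  assume "v \<in> B"
  with assms(2) show "u - v \<in> pm.span (relators P A y)"
    using pm.span_diff[of "w - v" _ "w - u"] by (simp add: B mem_cls_iff)
qed

lemma listset_update_split:
  assumes "xs \<in> listset As" "i < length As"
  shows "take i xs \<in> listset (take i As)" "drop (Suc i) xs \<in> listset (drop (Suc i) As)"
    "xs[i := x] = take i xs @ x # drop (Suc i) xs"
  using assms
  by (simp_all add: mem_listset_iff list_all2_lengthD upd_conv_take_nth_drop list_all2_takeI list_all2_dropI)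

lemma dualD:
  assumes "f \<in> dual P A y"
  shows "\<lbrakk>u \<in> Free P A y; v \<in> Free P A y\<rbrakk> \<Longrightarrow> f (cls P A y (u + v)) = f (cls P A y u) + f (cls P A y v)"
    and "u \<in> Free P A y \<Longrightarrow> f (cls P A y (pscale c u)) = c * f (cls P A y u)"
    and "finite {n. \<exists>u\<in>Free_deg P A y n. f (cls P A y u) \<noteq> 0}"
    and "B \<notin> free_alg P A y \<Longrightarrow> f B = 0"
  using assms by (simp_all add: dual_def)

lemma dual_sum:
  assumes f: "f \<in> dual P A y" and h: "\<And>i. i \<in> I \<Longrightarrow> h i \<in> Free P A y"
  shows "f (cls P A y (\<Sum>i\<in>I. h i)) = (\<Sum>i\<in>I. f (cls P A y (h i)))"
proof -
  have zero: "f (cls P A y 0) = 0"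
    using dualD(2)[OF f pm.subspace_0[OF subspace_Free], of 0] by simp
  show ?thesis
    using h
  proof (induction I rule: infinite_finite_induct)
    case (insert i I)
    then show ?case
      using dualD(1)[OF f, of "h i" "\<Sum>i\<in>I. h i"] by (simp add: pm.subspace_sum[OF subspace_Free])
  qed (simp_all add: zero)
qed

text \<open>Besides linearity this concerns the degrees: a sum is nonzero only in degrees where one
  of the summands is, and a multiple only where the function itself is.\<close>

lemma subspace_dual: "fn.subspace (dual P A y)"
proof (rule fn.subspaceI)
  show "0 \<in> dual P A y"
    by (simp add: dual_def)
next
  fix f g assume f: "f \<in> dual P A y" and g: "g \<in> dual P A y"
  have "finite {n. \<exists>u\<in>Free_deg P A y n. (f + g) (cls P A y u) \<noteq> 0}"
    by (rule finite_subset[OF _ finite_UnI[OF dualD(3)[OF f] dualD(3)[OF g]]]) auto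
  then show "f + g \<in> dual P A y"
    using f g by (simp add: dual_def algebra_simps)
next
  fix c f assume f: "f \<in> dual P A y"
  have "finite {n. \<exists>u\<in>Free_deg P A y n. fscale c f (cls P A y u) \<noteq> 0}"
    by (rule finite_subset[OF _ dualD(3)[OF f]]) (auto simp: fscale_def)
  then show "fscale c f \<in> dual P A y"
    using f by (simp add: dual_def fscale_def algebra_simps)
qed

section \<open>The action does not depend on representatives\<close>

context symmetric_operad
begin

lemma listset_keys_corollas:
  assumes "us \<in> listset (map (Free P A) xs)" "gs \<in> listset (map Poly_Mapping.keys us)"
  shows "gs \<in> listset (map (corollas P A) xs)"
  using assms by (auto simp: mem_listset_conv_nth Free_def)

lemma single_graft_in_Free:
  assumes "m \<in> Ops P" "us \<in> listset (map (Free P A) (inp m))" "gs \<in> listset (map Poly_Mapping.keys us)"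
  shows "Poly_Mapping.single (graft P m gs) c \<in> Free P A (out m)"
  using graft_in_corollas[OF assms(1) listset_keys_corollas[OF assms(2,3)]] by (simp add: Free_def)

lemma act_Free_in_Free:
  assumes "m \<in> Ops P" "us \<in> listset (map (Free P A) (inp m))"
  shows "act_Free P m us \<in> Free P A (out m)"
  unfolding act_Free_def
  by (intro pm.subspace_sum[OF subspace_Free] single_graft_in_Free[OF assms])

text \<open>By linearity the difference is the action with \<open>u - v\<close> in the chosen entry.
  Its expansion consists of grafts of \<open>u - v\<close> between fixed corollas.\<close>

lemma act_Free_cong_one:
  assumes m: "m \<in> Ops P" "inp m = xs @ x # ys"
    and us: "us \<in> listset (map (Free P A) xs)" and vs: "vs \<in> listset (map (Free P A) ys)"
    and uv: "u - v \<in> pm.span (relators P A x)"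
  shows "act_Free P m (us @ u # vs) - act_Free P m (us @ v # vs) \<in> pm.span (relators P A (out m))"
  unfolding act_Free_diff[symmetric]
  unfolding act_Free_split
  by (intro pm.span_sum, clarify, intro pm.span_scale lin_ext_graft_span[OF m _ _ uv]
      listset_keys_corollas[OF us] listset_keys_corollas[OF vs])

text \<open>Entries are exchanged one at a time from the left. The prefix \<open>ws\<close> holds
  the entries already exchanged, so that the induction can run over the remaining colours.\<close>

lemma act_Free_cong:
  assumes m: "m \<in> Ops P" "inp m = xs @ ys"
    and "ws \<in> listset (map (Free P A) xs)"
    and "us \<in> listset (map (Free P A) ys)" "vs \<in> listset (map (Free P A) ys)"
    and "\<And>i. i < length ys \<Longrightarrow> us ! i - vs ! i \<in> pm.span (relators P A (ys ! i))"
  shows "act_Free P m (ws @ us) - act_Free P m (ws @ vs) \<in> pm.span (relators P A (out m))"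
  using assms(2-)
proof (induction ys arbitrary: xs ws us vs)
  case Nil
  then show ?case by (simp add: pm.span_zero)
next
  case (Cons y ys)
  from Cons.prems(3,4) obtain u us' v vs' where
    u: "us = u # us'" "u \<in> Free P A y" "us' \<in> listset (map (Free P A) ys)" and
    v: "vs = v # vs'" "v \<in> Free P A y" "vs' \<in> listset (map (Free P A) ys)"
    by (auto simp: set_Cons_def)
  have "act_Free P m (ws @ u # us') - act_Free P m (ws @ v # us') \<in> pm.span (relators P A (out m))"
    using Cons.prems(5)[of 0] u v
    by (intro act_Free_cong_one[OF m(1) Cons.prems(1) Cons.prems(2)]) auto
  moreover have "act_Free P m ((ws @ [v]) @ us') - act_Free P m ((ws @ [v]) @ vs')
      \<in> pm.span (relators P A (out m))"
  proof (rule Cons.IH[of "xs @ [y]"])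
    show "ws @ [v] \<in> listset (map (Free P A) (xs @ [y]))"
      using Cons.prems(2) v(2) by (auto simp: mem_listset_iff intro!: list_all2_appendI)
    show "us' ! i - vs' ! i \<in> pm.span (relators P A (ys ! i))" if "i < length ys" for i
      using Cons.prems(5)[of "Suc i"] that u v by simp
  qed (use Cons.prems(1) u v in auto)
  ultimately have "act_Free P m (ws @ u # us') - act_Free P m (ws @ v # us')
    + (act_Free P m ((ws @ [v]) @ us') - act_Free P m ((ws @ [v]) @ vs')) \<in> pm.span (relators P A (out m))"
    by (rule pm.span_add)
  then show ?case
    by (simp add: u v)
qed

lemma listset_representatives:
  assumes "Bs \<in> listset (map (free_alg P A) xs)" "us \<in> listset Bs"
  shows "us \<in> listset (map (Free P A) xs)"
  using assms free_alg_memD(1) by (fastforce simp: mem_listset_conv_nth)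

text \<open>\<open>action\<close> is a union over all choices of representatives. All choices yield
  the same class, and \<open>us\<close> shows that there is one.\<close>

lemma action_eq_cls:
  assumes m: "m \<in> Ops P" and Bs: "Bs \<in> listset (map (free_alg P A) (inp m))" and us: "us \<in> listset Bs"
  shows "action P A m Bs = cls P A (out m) (act_Free P m us)"
proof -
  have eq: "cls P A (out m) (act_Free P m vs) = cls P A (out m) (act_Free P m us)" if vs: "vs \<in> listset Bs" for vs
  proof (rule cls_eqI)
    have "vs ! i - us ! i \<in> pm.span (relators P A (inp m ! i))" if "i < length (inp m)" for i
      using us vs Bs that by (intro free_alg_memD(2)) (auto simp: mem_listset_conv_nth)
    then show "act_Free P m vs - act_Free P m us \<in> pm.span (relators P A (out m))"
      using act_Free_cong[OF m, of "[]" "inp m" "[]" A vs us] listset_representatives[OF Bs us]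
        listset_representatives[OF Bs vs] by simp
  qed (intro act_Free_in_Free[OF m] listset_representatives[OF Bs] us vs)+
  have "listset Bs \<noteq> {}"
    using us by blast
  then show ?thesis
    unfolding action_def by (rule SUP_eq_const[OF _ eq])
qed

section \<open>Translations lie in the dual\<close>

text \<open>If the value at some \<open>u\<close> of degree \<open>n\<close> is nonzero, then
  \<open>f\<close> is nonzero on a single grafted corolla. Its degree is the sum of
  \<open>deg m\<close>, \<open>n\<close> and the degrees of the corollas taken from
  \<open>us\<close> and \<open>vs\<close>. Only finitely many total degrees are possible for
  \<open>f\<close>, and the supports of \<open>us\<close> and \<open>vs\<close> are finite, so
  finitely many \<open>n\<close> remain.\<close>

lemma finite_graft_degrees:
  assumes m: "m \<in> Ops P" "inp m = xs @ x # ys" and f: "f \<in> dual P A (out m)"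
    and us: "us \<in> listset (map (Free P A) xs)" and vs: "vs \<in> listset (map (Free P A) ys)"
  shows "finite {n. \<exists>u\<in>Free_deg P A x n. f (cls P A (out m) (act_Free P m (us @ u # vs))) \<noteq> 0}"
proof (rule finite_subset)
  let ?S = "{n. \<exists>u\<in>Free_deg P A (out m) n. f (cls P A (out m) u) \<noteq> 0}"
  let ?us = "listset (map Poly_Mapping.keys us)" and ?vs = "listset (map Poly_Mapping.keys vs)"
  show "finite ((\<lambda>(s, gs, hs). s - deg m - sum_list (map cdeg gs) - sum_list (map cdeg hs)) ` (?S \<times> ?us \<times> ?vs))"
    using dualD(3)[OF f] by (intro finite_imageI finite_cartesian_product finite_listset) auto
  show "{n. \<exists>u\<in>Free_deg P A x n. f (cls P A (out m) (act_Free P m (us @ u # vs))) \<noteq> 0} \<subseteq>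
    (\<lambda>(s, gs, hs). s - deg m - sum_list (map cdeg gs) - sum_list (map cdeg hs)) ` (?S \<times> ?us \<times> ?vs)"
  proof clarify
    fix n u
    assume u: "u \<in> Free_deg P A x n" and nz: "f (cls P A (out m) (act_Free P m (us @ u # vs))) \<noteq> 0"
    have all: "us @ u # vs \<in> listset (map (Free P A) (inp m))"
      using u us vs by (auto simp: m(2) Free_deg_def mem_listset_iff intro!: list_all2_appendI)
    \<comment> \<open>\<open>f\<close> distributes over the sum defining the action, so some summand
      contributes a nonzero value.\<close>
    obtain ks c where ks: "ks \<in> listset (map Poly_Mapping.keys (us @ u # vs))"
      and c: "f (cls P A (out m) (Poly_Mapping.single (graft P m ks) c)) \<noteq> 0"
      using nz unfolding act_Free_def
      by (subst (asm) dual_sum[OF f]) (auto intro: single_graft_in_Free[OF m(1) all] elim: sum.not_neutral_contains_not_neutral)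
    from ks obtain gs g hs where k: "ks = gs @ g # hs" "gs \<in> ?us" "g \<in> Poly_Mapping.keys u" "hs \<in> ?vs"
      using bij_betw_imp_surj_on[OF bij_betw_listset_split, symmetric, of "map Poly_Mapping.keys us"
          "Poly_Mapping.keys u" "map Poly_Mapping.keys vs"] by auto
    have "Poly_Mapping.single (graft P m ks) c \<in> Free_deg P A (out m) (cdeg (graft P m ks))"
      using single_graft_in_Free[OF m(1) all ks] by (simp add: Free_deg_def)
    with c have "cdeg (graft P m ks) \<in> ?S" by blast
    moreover have "cdeg g = n"
      using u k(3) by (simp add: Free_deg_def)
    ultimately show "n \<in> (\<lambda>(s, gs, hs). s - deg m - sum_list (map cdeg gs) - sum_list (map cdeg hs)) ` (?S \<times> ?us \<times> ?vs)"
      using k by (intro image_eqI[of _ _ "(cdeg (graft P m ks), gs, hs)"]) (auto simp: cdeg_graft)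
  qed
qed

text \<open>With representatives of the other arguments fixed, a translation is \<open>f\<close>
  applied to the action with one variable entry. This is linear in that entry, and
  \<open>finite_graft_degrees\<close> bounds its degrees.\<close>

lemma translation_in_dual:
  assumes m: "m \<in> Ops P" and f: "f \<in> dual P A (out m)"
    and Bs: "Bs \<in> listset (map (free_alg P A) (inp m))" and i: "i < length (inp m)"
  shows "translation P A f m i Bs \<in> dual P A (inp m ! i)"
proof -
  obtain us where us: "us \<in> listset Bs"
  proof
    show "map (\<lambda>B. SOME u. u \<in> B) Bs \<in> listset Bs"
      using Bs by (auto simp: mem_listset_conv_nth intro!: someI_ex[OF free_alg_nonempty])
  qed
  let ?x = "inp m ! i" and ?us = "take i us" and ?vs = "drop (Suc i) us"
  have us_Free: "us \<in> listset (map (Free P A) (inp m))"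
    by (rule listset_representatives[OF Bs us])
  have pre: "?us \<in> listset (map (Free P A) (take i (inp m)))"
    and post: "?vs \<in> listset (map (Free P A) (drop (Suc i) (inp m)))"
    using listset_update_split(1,2)[OF us_Free, of i] i by (simp_all add: take_map drop_map)
  have inp: "inp m = take i (inp m) @ ?x # drop (Suc i) (inp m)"
    using i by (rule id_take_nth_drop)
  have upd: "?us @ u # ?vs \<in> listset (map (Free P A) (inp m))" if "u \<in> Free P A ?x" for u
    using listset_update[OF us_Free, of u i] listset_update_split(3)[OF us_Free] i that by simp
  have eval: "translation P A f m i Bs (cls P A ?x u) = f (cls P A (out m) (act_Free P m (?us @ u # ?vs)))"
    if u: "u \<in> Free P A ?x" for u
  proof -
    have "us[i := u] \<in> listset (Bs[i := cls P A ?x u])"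
      using us self_mem_cls[OF u] by (simp add: mem_listset_iff list_all2_update_cong)
    moreover have "Bs[i := cls P A ?x u] \<in> listset (map (free_alg P A) (inp m))"
      using i by (intro listset_update[OF Bs]) (simp add: cls_in_free_alg[OF u])
    ultimately have "action P A m (Bs[i := cls P A ?x u]) = cls P A (out m) (act_Free P m (us[i := u]))"
      by (intro action_eq_cls[OF m])
    then show ?thesis
      using listset_update_split(3)[OF us_Free] i
      by (simp add: translation_def cls_in_free_alg[OF u])
  qed
  have "finite {n. \<exists>u\<in>Free_deg P A ?x n. translation P A f m i Bs (cls P A ?x u) \<noteq> 0}"
    by (rule finite_subset[OF _ finite_graft_degrees[OF m inp f pre post]])
      (auto simp: Free_deg_def eval)
  moreover have "u + v \<in> Free P A ?x" "pscale c u \<in> Free P A ?x"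
    if "u \<in> Free P A ?x" "v \<in> Free P A ?x" for u v c
    using that by (simp_all add: pm.subspace_add[OF subspace_Free] pm.subspace_scale[OF subspace_Free])
  \<comment> \<open>Vanishing outside the free algebra, the last clause of \<open>dual\<close>, is
    built into \<open>translation\<close>.\<close>
  ultimately show ?thesis
    by (simp add: dual_def eval act_Free_add act_Free_pscale dualD(1,2)[OF f] act_Free_in_Free[OF m upd])
      (simp add: translation_def)
qed

section \<open>The two implications\<close>

lemma representative_imp_recursive:
  assumes "representative P A y f"
  shows "recursive P A y f"
  unfolding recursive_def translation_space_def
proof (intro ballI impI allI)
  fix m i assume m: "m \<in> Ops P" "out m = y" and i: "i < length (inp m)"
  obtain r :: nat and c g where
    g: "\<And>j i. \<lbrakk>j < r; i < length (inp m)\<rbrakk> \<Longrightarrow> g j i \<in> dual P A (inp m ! i)"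
    and f: "\<And>Bs. Bs \<in> listset (map (free_alg P A) (inp m)) \<Longrightarrow>
      f (action P A m Bs) = (\<Sum>j<r. c j * (\<Prod>i<length (inp m). g j i (Bs ! i)))"
    using assms[unfolded representative_def, rule_format, OF m] by blast
  let ?G = "(\<lambda>j. g j i) ` {..<r}"
  have "translation P A f m i Bs \<in> fn.span ?G" if Bs: "Bs \<in> listset (map (free_alg P A) (inp m))" for Bs
  proof -
    \<comment> \<open>Once the other arguments are fixed, their factors are scalars and join the
      coefficient \<open>c j\<close>.\<close>
    define d where "d j = c j * (\<Prod>l\<in>{..<length (inp m)} - {i}. g j l (Bs ! l))" for j
    have len: "length Bs = length (inp m)"
      using Bs by (simp add: mem_listset_conv_nth)
    have "translation P A f m i Bs B = (\<Sum>j<r. fscale (d j) (g j i)) B" for B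
    proof (cases "B \<in> free_alg P A (inp m ! i)")
      case True
      then have "Bs[i := B] \<in> listset (map (free_alg P A) (inp m))"
        using i by (intro listset_update[OF Bs]) simp
      moreover have "(\<Prod>l<length (inp m). g j l (Bs[i := B] ! l))
          = g j i B * (\<Prod>l\<in>{..<length (inp m)} - {i}. g j l (Bs ! l))" for j
        using i len by (subst prod.remove[of _ i]) auto
      ultimately show ?thesis
        using True by (simp add: translation_def f sum_fun_apply fscale_def d_def mult_ac)
    next
      case False
      \<comment> \<open>Here both sides are 0: \<open>translation\<close> by definition, and each
        \<open>g j i\<close> because it lies in the dual.\<close>
      then show ?thesis
        using dualD(4)[OF g] i by (simp add: translation_def sum_fun_apply fscale_def)
    qed
    then have "translation P A f m i Bs = (\<Sum>j<r. fscale (d j) (g j i))" ..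
    also have "\<dots> \<in> fn.span ?G"
      by (intro fn.span_sum fn.span_scale fn.span_base) auto
    finally show ?thesis .
  qed
  then show "\<exists>G. finite G \<and>
      fn.span (translation P A f m i ` listset (map (free_alg P A) (inp m))) = fn.span G"
    using span_eq_span_finite[of "translation P A f m i ` listset (map (free_alg P A) (inp m))" ?G] by auto
qed

lemma recursive_imp_representative:
  assumes rec: "recursive P A y f" and f: "f \<in> dual P A y"
  shows "representative P A y f"
  unfolding representative_def
proof (intro ballI impI)
  fix m assume m: "m \<in> Ops P" "out m = y"
  let ?As = "map (free_alg P A) (inp m)"
  let ?F = "\<lambda>Bs. f (action P A m Bs)"
  have "\<exists>L. (\<forall>(c, g)\<in>set L. \<forall>i<length ?As. g i \<in> dual P A (inp m ! i)) \<and>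
    (\<forall>Bs\<in>listset ?As. ?F Bs = (\<Sum>(c, g)\<leftarrow>L. c * (\<Prod>i<length ?As. g i (Bs ! i))))"
  proof (rule decompose_by_positions)
    fix i assume "i < length ?As"
    then have i: "i < length (inp m)" by simp
    obtain G where "finite G" and G: "translation_space P A f m i = fn.span G"
      using rec[unfolded recursive_def, rule_format, OF m i] by blast
    \<comment> \<open>The functions \<open>e a\<close> obtained below are combinations of
      translations, so this places them in the dual.\<close>
    have span_dual: "fn.span G \<subseteq> dual P A (inp m ! i)"
      unfolding G[symmetric] translation_space_def
      using translation_in_dual[OF m(1) _ _ i] f m(2) by (intro fn.span_minimal subspace_dual) auto
    obtain r :: nat and e b where
      eb: "\<forall>a<r. e a \<in> fn.span G \<and> (\<exists>h\<in>fn.span G. h (b a) \<noteq> 0)"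
      and h: "\<forall>h\<in>fn.span G. \<forall>x. h x = (\<Sum>a<r. h (b a) * e a x)"
      using function_space_dual_basis[OF \<open>finite G\<close>] by blast
    \<comment> \<open>A node is a priori an arbitrary point. A functional in the dual that is
      nonzero there shows that it belongs to the free algebra.\<close>
    have b_alg: "b a \<in> free_alg P A (inp m ! i)" if "a < r" for a
    proof -
      from eb that obtain h where "h \<in> fn.span G" "h (b a) \<noteq> 0"
        by auto
      then show ?thesis
        using span_dual dualD(4)[of h P A "inp m ! i" "b a"] by auto
    qed
    have "?F Bs = (\<Sum>a<r. ?F (Bs[i := b a]) * e a (Bs ! i))" if Bs: "Bs \<in> listset ?As" for Bs
    proof -
      have t: "translation P A f m i Bs \<in> fn.span G"
        using Bs unfolding G[symmetric] translation_space_def by (intro fn.span_base) simp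
      have "Bs ! i \<in> free_alg P A (inp m ! i)"
        using Bs i by (simp add: mem_listset_conv_nth)
      \<comment> \<open>The interpolation formula for this translation is evaluated at
        \<open>Bs ! i\<close>, where updating \<open>Bs\<close> changes nothing; its value at the
        node \<open>b a\<close> is \<open>?F (Bs[i := b a])\<close>.\<close>
      then show ?thesis
        using h[rule_format, OF t, of "Bs ! i"] b_alg by (simp add: translation_def)
    qed
    then show "\<exists>(r::nat) e b. (\<forall>a<r. e a \<in> dual P A (inp m ! i) \<and> b a \<in> ?As ! i) \<and>
      (\<forall>Bs\<in>listset ?As. ?F Bs = (\<Sum>a<r. ?F (Bs[i := b a]) * e a (Bs ! i)))"
      using eb b_alg span_dual i by (intro exI[of _ r] exI[of _ e] exI[of _ b]) auto
  qed
  then obtain L where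
    L: "\<forall>p\<in>set L. \<forall>i<length (inp m). snd p i \<in> dual P A (inp m ! i)"
    and FL: "\<forall>Bs\<in>listset ?As. ?F Bs = (\<Sum>p\<leftarrow>L. fst p * (\<Prod>i<length (inp m). snd p i (Bs ! i)))"
    by (auto simp: case_prod_unfold)
  have "snd (L ! j) i \<in> dual P A (inp m ! i)" if "j < length L" "i < length (inp m)" for j i
    using L that by simp
  moreover have "?F Bs = (\<Sum>j<length L. fst (L ! j) * (\<Prod>i<length (inp m). snd (L ! j) i (Bs ! i)))"
    if "Bs \<in> listset ?As" for Bs
    using FL[rule_format, OF that] by (simp add: sum_list_sum_nth lessThan_atLeast0)
  ultimately show "\<exists>(r::nat) c g.
      (\<forall>j<r. \<forall>i<length (inp m). g j i \<in> dual P A (inp m ! i)) \<and>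
      (\<forall>Bs\<in>listset ?As. ?F Bs = (\<Sum>j<r. c j * (\<Prod>i<length (inp m). g j i (Bs ! i))))"
    by (intro exI[of _ "length L"] exI[of _ "\<lambda>j. fst (L ! j)"] exI[of _ "\<lambda>j. snd (L ! j)"]) simp
qed

end

theorem proposition3p2p1:
  fixes V :: base
    and P :: "('k::field, 'x, 'p::ab_group_add) operad"
    and A :: "'x \<Rightarrow> ('k, 'a::ab_group_add) complex"
    and y :: 'x
    and f :: "('k, 'x, 'p, 'a) free_elt \<Rightarrow> 'k"
  assumes "symmetric_operad V P"
    and "\<And>x. in_base V (A x)"
    and "f \<in> dual P A y"
  shows "representative P A y f \<longleftrightarrow> recursive P A y f"
proof -
  interpret symmetric_operad V P by (rule assms(1))
  show ?thesis
    by (rule iffI[OF representative_imp_recursive recursive_imp_representative[OF _ assms(3)]])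
qed

end
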